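(* Let $X$ be a locally compact Hausdorff space with a countable basis to its topology, let $\mathrm{d}x$ be a regular Borel measure on $X$ with support equal to $X$, and let $1\le p<\infty$. Let $T_t=\mathrm{e}^{Zt}$ ($t\ge 0$) be a positive one-parameter contraction semigroup with the Feller property acting on $L^p(X,\mathrm{d}x)$. Let $\mathcal{N}$ be the real subspace defined in the context. Then $T_t|_{\mathcal{N}}=I$ (the identity) for all $t\ge 0$. Hence the peripheral point spectrum $P$ of $Z$ cannot contain any non-zero points.
   Context: One-parameter semigroups are strongly continuous, with $T_0=I$, and $Z$ denotes the generator. Here $\mathcal{B}=L^p(X,\mathrm{d}x)$ is the space of complex-valued functions, assumed separable. Contraction means $\Vert T_t\Vert\le 1$ for all $t\ge 0$. Positive means that $T_t$ commutes with complex conjugation and maps non-negative functions to non-negative functions. The Feller property means that $T_tf\in C(X)$ for all $f\in\mathcal{B}$ and $t>0$ (i.e. $T_tf$ has a continuous representative), where $C(X)$ is the space of all continuous functions on $X$. For $\theta\in\mathbf{R}$ put $\mathcal{L}_\theta=\{f\in\mathrm{Dom}(Z):Zf=i\theta f\}=\{f\in\mathcal{B}:T_tf=\mathrm{e}^{i\theta t}f\text{ for all }t\ge 0\}$. The peripheral point spectrum is $P=\{\theta\in\mathbf{R}:\mathcal{L}_\theta\ne\{0\}\}$. Let $\mathcal{L}$ be the closed linear span of $\bigcup\{\mathcal{L}_\theta:\theta\in P\}$. Fix a sequence $t(n)\to+\infty$ such that $\lim_{n\to\infty}\Vert T_{t(n)}f-f\Vert=0$ for all $f\in\mathcal{L}$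 (such a sequence exists). Put $\mathcal{M}=\{f\in\mathcal{B}:\lim_{n\to\infty}\Vert T_{t(n)}f-f\Vert=0\}$, and let $\mathcal{N}$ be the set of real-valued elements of $\mathcal{M}$. *)

theory Defs
  imports "HOL-Analysis.Analysis"
begin

definition regular_borel_measure :: "'a::t2_space measure \<Rightarrow> bool" where
  "regular_borel_measure M \<longleftrightarrow>
     sets M = sets borel \<and>
     (\<forall>K. compact K \<longrightarrow> emeasure M K < \<infinity>) \<and>
     (\<forall>A\<in>sets M. emeasure M A = (INF U \<in> {U. open U \<and> A \<subseteq> U}. emeasure M U)) \<and>
     (\<forall>U. open U \<longrightarrow>
        emeasure M U = (SUP K \<in> {K. compact K \<and> K \<subseteq> U}. emeasure M K))"

definition measure_support :: "'a::topological_space measure \<Rightarrow> 'a set" where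
  "measure_support M = {x. \<forall>U. open U \<longrightarrow> x \<in> U \<longrightarrow> 0 < emeasure M U}"

text \<open>
  The complex space \<open>L\<^sup>p\<close> is represented by its functions rather than by their classes modulo
  null sets: two members of \<open>Lp p M\<close> are the same vector iff they agree almost everywhere, and
  every identity between vectors below is stated as an almost everywhere identity. The value of
  \<open>Lp_norm\<close> is meaningful only on \<open>Lp p M\<close>.
\<close>

definition Lp :: "real \<Rightarrow> 'a measure \<Rightarrow> ('a \<Rightarrow> complex) set" where
  "Lp p M = {f \<in> borel_measurable M. integrable M (\<lambda>x. cmod (f x) powr p)}"

definition Lp_norm :: "real \<Rightarrow> 'a measure \<Rightarrow> ('a \<Rightarrow> complex) \<Rightarrow> real" where
  "Lp_norm p M f = (\<integral>x. cmod (f x) powr p \<partial>M) powr (1 / p)"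

definition Lp_separable :: "real \<Rightarrow> 'a measure \<Rightarrow> bool" where
  "Lp_separable p M \<longleftrightarrow>
     (\<exists>D. countable D \<and> D \<subseteq> Lp p M \<and>
        (\<forall>f\<in>Lp p M. \<forall>e>0. \<exists>g\<in>D. Lp_norm p M (\<lambda>x. f x - g x) < e))"

text \<open>
  The second conjunct says that the operator is well defined on classes modulo null sets.
\<close>

definition bounded_operator_Lp ::
    "real \<Rightarrow> 'a measure \<Rightarrow> (('a \<Rightarrow> complex) \<Rightarrow> 'a \<Rightarrow> complex) \<Rightarrow> bool" where
  "bounded_operator_Lp p M A \<longleftrightarrow>
     (\<forall>f\<in>Lp p M. A f \<in> Lp p M) \<and>
     (\<forall>f\<in>Lp p M. \<forall>g\<in>Lp p M. (AE x in M. f x = g x) \<longrightarrow> (AE x in M. A f x = A g x)) \<and>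
     (\<forall>f\<in>Lp p M. \<forall>g\<in>Lp p M. AE x in M. A (\<lambda>y. f y + g y) x = A f x + A g x) \<and>
     (\<forall>c. \<forall>f\<in>Lp p M. AE x in M. A (\<lambda>y. c * f y) x = c * A f x) \<and>
     (\<exists>C. \<forall>f\<in>Lp p M. Lp_norm p M (A f) \<le> C * Lp_norm p M f)"

text \<open>
  Only the operators \<open>T t\<close> with \<open>0 \<le> t\<close> are relevant.
\<close>

definition one_parameter_semigroup ::
    "real \<Rightarrow> 'a measure \<Rightarrow> (real \<Rightarrow> ('a \<Rightarrow> complex) \<Rightarrow> 'a \<Rightarrow> complex) \<Rightarrow> bool" where
  "one_parameter_semigroup p M T \<longleftrightarrow>
     (\<forall>t\<ge>0. bounded_operator_Lp p M (T t)) \<and>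
     (\<forall>f\<in>Lp p M. AE x in M. T 0 f x = f x) \<and>
     (\<forall>s\<ge>0. \<forall>t\<ge>0. \<forall>f\<in>Lp p M. AE x in M. T (s + t) f x = T s (T t f) x) \<and>
     (\<forall>f\<in>Lp p M. \<forall>s\<ge>0.
        ((\<lambda>t. Lp_norm p M (\<lambda>x. T t f x - T s f x)) \<longlongrightarrow> 0) (at s within {0..}))"

definition contraction_semigroup ::
    "real \<Rightarrow> 'a measure \<Rightarrow> (real \<Rightarrow> ('a \<Rightarrow> complex) \<Rightarrow> 'a \<Rightarrow> complex) \<Rightarrow> bool" where
  "contraction_semigroup p M T \<longleftrightarrow>
     one_parameter_semigroup p M T \<and>
     (\<forall>t\<ge>0. \<forall>f\<in>Lp p M. Lp_norm p M (T t f) \<le> Lp_norm p M f)"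

definition positive_semigroup ::
    "real \<Rightarrow> 'a measure \<Rightarrow> (real \<Rightarrow> ('a \<Rightarrow> complex) \<Rightarrow> 'a \<Rightarrow> complex) \<Rightarrow> bool" where
  "positive_semigroup p M T \<longleftrightarrow>
     one_parameter_semigroup p M T \<and>
     (\<forall>t\<ge>0. \<forall>f\<in>Lp p M. AE x in M. T t (\<lambda>y. cnj (f y)) x = cnj (T t f x)) \<and>
     (\<forall>t\<ge>0. \<forall>f\<in>Lp p M. (AE x in M. f x \<in> \<real>\<^sub>\<ge>\<^sub>0) \<longrightarrow> (AE x in M. T t f x \<in> \<real>\<^sub>\<ge>\<^sub>0))"

definition Feller_property ::
    "real \<Rightarrow> 'a::topological_space measure \<Rightarrow> (real \<Rightarrow> ('a \<Rightarrow> complex) \<Rightarrow> 'a \<Rightarrow> complex) \<Rightarrow> bool" where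
  "Feller_property p M T \<longleftrightarrow>
     (\<forall>f\<in>Lp p M. \<forall>t>0. \<exists>g. continuous_on UNIV g \<and> (AE x in M. T t f x = g x))"

text \<open>
  The generator \<open>Z\<close> is given by its graph: \<open>(f, g)\<close> belongs to it iff \<open>f\<close> is in the domain
  of \<open>Z\<close> and \<open>Z f = g\<close>.
\<close>

definition generator ::
    "real \<Rightarrow> 'a measure \<Rightarrow> (real \<Rightarrow> ('a \<Rightarrow> complex) \<Rightarrow> 'a \<Rightarrow> complex)
      \<Rightarrow> (('a \<Rightarrow> complex) \<times> ('a \<Rightarrow> complex)) set" where
  "generator p M T = {(f, g). f \<in> Lp p M \<and> g \<in> Lp p M \<and>
     ((\<lambda>t. Lp_norm p M (\<lambda>x. (T t f x - f x) / complex_of_real t - g x)) \<longlongrightarrow> 0) (at_right 0)}"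

definition peripheral_eigenspace ::
    "real \<Rightarrow> 'a measure \<Rightarrow> (real \<Rightarrow> ('a \<Rightarrow> complex) \<Rightarrow> 'a \<Rightarrow> complex)
      \<Rightarrow> real \<Rightarrow> ('a \<Rightarrow> complex) set" where
  "peripheral_eigenspace p M T \<theta> =
     {f. (f, \<lambda>x. \<i> * complex_of_real \<theta> * f x) \<in> generator p M T}"

definition peripheral_point_spectrum ::
    "real \<Rightarrow> 'a measure \<Rightarrow> (real \<Rightarrow> ('a \<Rightarrow> complex) \<Rightarrow> 'a \<Rightarrow> complex) \<Rightarrow> real set" where
  "peripheral_point_spectrum p M T =
     {\<theta>. \<exists>f\<in>peripheral_eigenspace p M T \<theta>. \<not> (AE x in M. f x = 0)}"

definition linear_span :: "('a \<Rightarrow> complex) set \<Rightarrow> ('a \<Rightarrow> complex) set" where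
  "linear_span A = {(\<lambda>x. \<Sum>g\<in>S. c g * g x) | S c. finite S \<and> S \<subseteq> A}"

definition closed_linear_span ::
    "real \<Rightarrow> 'a measure \<Rightarrow> ('a \<Rightarrow> complex) set \<Rightarrow> ('a \<Rightarrow> complex) set" where
  "closed_linear_span p M A =
     {f \<in> Lp p M. \<forall>e>0. \<exists>g\<in>linear_span A. Lp_norm p M (\<lambda>x. f x - g x) < e}"

definition peripheral_subspace ::
    "real \<Rightarrow> 'a measure \<Rightarrow> (real \<Rightarrow> ('a \<Rightarrow> complex) \<Rightarrow> 'a \<Rightarrow> complex) \<Rightarrow> ('a \<Rightarrow> complex) set" where
  "peripheral_subspace p M T =
     closed_linear_span p M
       (\<Union>\<theta>\<in>peripheral_point_spectrum p M T. peripheral_eigenspace p M T \<theta>)"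

definition recurrent_subspace ::
    "real \<Rightarrow> 'a measure \<Rightarrow> (real \<Rightarrow> ('a \<Rightarrow> complex) \<Rightarrow> 'a \<Rightarrow> complex)
      \<Rightarrow> (nat \<Rightarrow> real) \<Rightarrow> ('a \<Rightarrow> complex) set" where
  "recurrent_subspace p M T \<tau> =
     {f \<in> Lp p M. (\<lambda>n. Lp_norm p M (\<lambda>x. T (\<tau> n) f x - f x)) \<longlonglongrightarrow> 0}"

definition real_recurrent_subspace ::
    "real \<Rightarrow> 'a measure \<Rightarrow> (real \<Rightarrow> ('a \<Rightarrow> complex) \<Rightarrow> 'a \<Rightarrow> complex)
      \<Rightarrow> (nat \<Rightarrow> real) \<Rightarrow> ('a \<Rightarrow> complex) set" where
  "real_recurrent_subspace p M T \<tau> =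
     {f \<in> recurrent_subspace p M T \<tau>. AE x in M. f x \<in> \<real>}"

end

theory Submission
  imports Defs
begin

text \<open>
  Let \<open>N\<close> be the space of real functions \<open>f\<close> in \<open>L\<^sup>p\<close> with \<open>T (\<tau> n) f \<longlongrightarrow> f\<close>. On \<open>N\<close> the
  contractions \<open>T t\<close> are isometric, and strict monotonicity of the norm turns
  \<open>\<bar>T t f\<bar> \<le> T t \<bar>f\<bar>\<close> into an equality: \<open>N\<close> is a closed sublattice on which \<open>T t\<close> acts by lattice
  homomorphisms. By the Feller property \<open>\<phi> f = (T 1 f) x\<close> is a well-defined positive, hence
  bounded, functional on \<open>L\<^sup>p\<close>, and a lattice homomorphism on \<open>N\<close>.

  Fix \<open>0 \<le> g\<close> in \<open>N\<close> with \<open>\<phi> g > 0\<close>. The functions \<open>0 \<le> f\<close> in \<open>N\<close> with \<open>\<phi> f = \<phi> g\<close> are closed under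
  minima, so they have a least element \<open>e\<close>. With \<open>l t = \<phi> (T t e) / \<phi> e\<close>, minimality gives
  \<open>l t * e \<le> T t e\<close>, with remainder disjoint from \<open>e\<close>, whence \<open>l (\<tau> n) = l s * l (\<tau> n - s)\<close> for small
  \<open>s\<close> and large \<open>n\<close>. As \<open>l \<le> 1\<close> and \<open>l (\<tau> n) \<longlongrightarrow> 1\<close>, this forces \<open>l s = 1\<close> and \<open>T s e = e\<close>. Therefore
  \<open>\<phi> (T t g) \<ge> \<phi> (T t e) = \<phi> g\<close> at every point \<open>x\<close>, that is \<open>T 1 (T t g) \<ge> T 1 g\<close>, and equality of
  norms yields \<open>T t g = g\<close>.

  An eigenvector for \<open>\<i> \<theta>\<close> with \<open>\<theta> \<noteq> 0\<close> is recurrent along \<open>\<tau> n = 2 \<pi> n / \<bar>\<theta>\<bar>\<close>, so it would be fixed.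
\<close>

section \<open>The spaces of \<open>p\<close>-integrable functions\<close>

text \<open>This is convexity of \<open>\<lambda>w. w powr p\<close> at the points
  \<open>u / a\<close> and \<open>v / b\<close> with weights proportional to \<open>a\<close> and
  \<open>b\<close>. With \<open>a\<close> and \<open>b\<close> above the norms of two functions,
  integrating it yields Minkowski's inequality without a detour through dual exponents.\<close>

lemma powr_convex_combination:
  fixes u v a b p :: real
  assumes "1 \<le> p" "0 \<le> u" "0 \<le> v" "0 < a" "0 < b"
  shows "((u + v) / (a + b)) powr p
    \<le> a / (a + b) * (u powr p / a powr p) + b / (a + b) * (v powr p / b powr p)"
proof -
  \<comment> \<open>This settles the cases \<open>u = 0\<close> and \<open>v = 0\<close>, which the
    convexity argument below on positive arguments does not reach: a ratio below 1 only shrinks when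
    raised to a power \<open>p \<ge> 1\<close>.\<close>
  have c: "(w / (a + b)) powr p \<le> d / (a + b) * (w powr p / d powr p)"
    if "0 \<le> w" "0 < d" "d < a + b" for w d
  proof -
    have "(w / (a + b)) powr p = (d / (a + b)) powr p * (w / d) powr p"
      using that by (simp flip: powr_mult)
    also have "\<dots> \<le> (d / (a + b)) powr 1 * (w / d) powr p"
      using that assms by (intro mult_right_mono powr_mono') auto
    finally show ?thesis using that by (simp add: powr_divide)
  qed
  consider "u = 0" | "v = 0" | "0 < u" "0 < v" using assms by linarith
  then show ?thesis
  proof cases
    case 1
    then show ?thesis using c[of v b] assms by simp
  next
    case 2
    then show ?thesis using c[of u a] assms by simp
  next
    case 3
    from convex_onD[OF powr_convex[OF assms(1)], of "b / (a + b)" "u / a" "v / b"] 3 assms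
    have "((1 - b / (a + b)) * (u / a) + b / (a + b) * (v / b)) powr p
       \<le> (1 - b / (a + b)) * (u / a) powr p + b / (a + b) * (v / b) powr p" by simp
    moreover have "1 - b / (a + b) = a / (a + b)"
      using assms by (simp add: field_simps)
    moreover have "a / (a + b) * (u / a) + b / (a + b) * (v / b) = (u + v) / (a + b)"
      using assms by (simp add: add_divide_distrib)
    ultimately show ?thesis using assms by (simp add: powr_divide)
  qed
qed

text \<open>The value space is kept general so that complex functions and their real and imaginary
  parts share one set of lemmas; at type \<open>complex\<close> this is \<open>Lp\<close>.\<close>

definition Lp_on :: "real \<Rightarrow> 'a measure \<Rightarrow> ('a \<Rightarrow> 'b::{banach, second_countable_topology}) set" where
  "Lp_on p M = {f \<in> borel_measurable M. integrable M (\<lambda>x. norm (f x) powr p)}"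

definition Lp_on_norm :: "real \<Rightarrow> 'a measure \<Rightarrow> ('a \<Rightarrow> 'b::{banach, second_countable_topology}) \<Rightarrow> real" where
  "Lp_on_norm p M f = (\<integral>x. norm (f x) powr p \<partial>M) powr (1 / p)"

section \<open>Order, scaling and the triangle inequality in L^p\<close>

lemma Lp_on_measurable [measurable_dest]: "f \<in> Lp_on p M \<Longrightarrow> f \<in> borel_measurable M"
  by (simp add: Lp_on_def)

lemma Lp_on_integrable: "f \<in> Lp_on p M \<Longrightarrow> integrable M (\<lambda>x. norm (f x) powr p)"
  by (simp add: Lp_on_def)

lemma Lp_onI:
  assumes "g \<in> Lp_on p M" "f \<in> borel_measurable M" "AE x in M. norm (f x) \<le> norm (g x)" "0 \<le> p"
  shows "f \<in> Lp_on p M"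
proof -
  have "integrable M (\<lambda>x. norm (f x) powr p)"
    using Lp_on_integrable[OF assms(1)]
  proof (rule Bochner_Integration.integrable_bound)
    show "AE x in M. norm (norm (f x) powr p) \<le> norm (norm (g x) powr p)"
      using assms(3) by eventually_elim (simp add: powr_mono2 assms(4))
  qed (use assms(2) in measurable)
  then show ?thesis using assms(2) by (simp add: Lp_on_def)
qed

lemma Lp_on_norm_nonneg: "0 \<le> Lp_on_norm p M f"
  by (simp add: Lp_on_norm_def)

lemma Lp_on_norm_powr:
  assumes "1 \<le> p"
  shows "Lp_on_norm p M f powr p = (\<integral>x. norm (f x) powr p \<partial>M)"
  using assms by (simp add: Lp_on_norm_def powr_powr)

lemma Lp_on_norm_le_iff:
  assumes "1 \<le> p" "0 \<le> c"
  shows "Lp_on_norm p M f \<le> c \<longleftrightarrow> (\<integral>x. norm (f x) powr p \<partial>M) \<le> c powr p"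
proof -
  have "Lp_on_norm p M f \<le> c \<longleftrightarrow> Lp_on_norm p M f powr p \<le> c powr p"
    using powr_mono2[of p "Lp_on_norm p M f" c] powr_less_mono2[of p c "Lp_on_norm p M f"] assms
    by (cases "Lp_on_norm p M f \<le> c") (simp_all add: Lp_on_norm_nonneg)
  then show ?thesis using assms(1) by (simp add: Lp_on_norm_powr)
qed

lemma Lp_on_norm_mono:
  assumes "1 \<le> p" "g \<in> Lp_on p M" "f \<in> borel_measurable M" "AE x in M. norm (f x) \<le> norm (g x)"
  shows "Lp_on_norm p M f \<le> Lp_on_norm p M g"
proof -
  have f: "f \<in> Lp_on p M" by (rule Lp_onI[OF assms(2,3,4)]) (use assms(1) in auto)
  have "(\<integral>x. norm (f x) powr p \<partial>M) \<le> (\<integral>x. norm (g x) powr p \<partial>M)"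
  proof (rule integral_mono_AE)
    show "AE x in M. norm (f x) powr p \<le> norm (g x) powr p"
      using assms(4) by eventually_elim (use assms(1) in \<open>simp add: powr_mono2\<close>)
  qed (use f assms(2) in \<open>auto intro: Lp_on_integrable\<close>)
  then show ?thesis
    using assms(1) by (simp add: Lp_on_norm_le_iff Lp_on_norm_nonneg Lp_on_norm_powr)
qed

lemma Lp_on_norm_cong_AE:
  assumes "f \<in> borel_measurable M" "g \<in> borel_measurable M" "AE x in M. norm (f x) = norm (g x)"
  shows "Lp_on_norm p M f = Lp_on_norm p M g"
proof -
  have "(\<integral>x. norm (f x) powr p \<partial>M) = (\<integral>x. norm (g x) powr p \<partial>M)"
  proof (rule integral_cong_AE)
    show "AE x in M. norm (f x) powr p = norm (g x) powr p"
      using assms(3) by eventually_elim simp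
  qed (use assms in measurable)
  then show ?thesis by (simp add: Lp_on_norm_def)
qed

lemma Lp_on_norm_eq_0_iff:
  assumes "1 \<le> p" "f \<in> Lp_on p M"
  shows "Lp_on_norm p M f = 0 \<longleftrightarrow> (AE x in M. f x = 0)"
proof -
  have "Lp_on_norm p M f = 0 \<longleftrightarrow> (\<integral>x. norm (f x) powr p \<partial>M) = 0"
    by (simp add: Lp_on_norm_def)
  also have "\<dots> \<longleftrightarrow> (AE x in M. norm (f x) powr p = 0)"
    using assms by (intro integral_nonneg_eq_0_iff_AE) (auto intro: Lp_on_integrable)
  finally show ?thesis by simp
qed

lemma Lp_on_scale:
  assumes "1 \<le> p" "f \<in> Lp_on p M"
  shows "(\<lambda>x. c *\<^sub>R f x) \<in> Lp_on p M" "Lp_on_norm p M (\<lambda>x. c *\<^sub>R f x) = \<bar>c\<bar> * Lp_on_norm p M f"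
proof -
  have *: "norm (c *\<^sub>R f x) powr p = \<bar>c\<bar> powr p * norm (f x) powr p" for x
    by (simp add: powr_mult)
  show "(\<lambda>x. c *\<^sub>R f x) \<in> Lp_on p M"
    using assms(2) unfolding Lp_on_def mem_Collect_eq * by auto
  show "Lp_on_norm p M (\<lambda>x. c *\<^sub>R f x) = \<bar>c\<bar> * Lp_on_norm p M f"
    using assms(1) unfolding Lp_on_norm_def * by (simp add: powr_mult powr_powr)
qed

text \<open>The bounds \<open>a\<close> and \<open>b\<close> stand in for the norms themselves,
  which may vanish and could not serve as denominators. \<open>Lp_on_add\<close> then takes them
  arbitrarily close to the norms.\<close>

lemma Lp_on_add_aux:
  assumes p: "1 \<le> p" and f: "f \<in> Lp_on p M" and g: "g \<in> Lp_on p M"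
    and ab: "0 < a" "0 < b" "Lp_on_norm p M f \<le> a" "Lp_on_norm p M g \<le> b"
  shows "(\<lambda>x. f x + g x) \<in> Lp_on p M" "Lp_on_norm p M (\<lambda>x. f x + g x) \<le> a + b"
proof -
  let ?h = "\<lambda>x. (a + b) powr p * (a / (a + b) * (norm (f x) powr p / a powr p)
     + b / (a + b) * (norm (g x) powr p / b powr p))"
  have le: "norm (f x + g x) powr p \<le> ?h x" for x
  proof -
    have "norm (f x + g x) powr p \<le> (norm (f x) + norm (g x)) powr p"
      using p by (intro powr_mono2) (auto intro: norm_triangle_ineq)
    also have "\<dots> = (a + b) powr p * ((norm (f x) + norm (g x)) / (a + b)) powr p"
      using ab by (simp add: powr_divide)
    also have "\<dots> \<le> ?h x"
      using powr_convex_combination[OF p norm_ge_zero norm_ge_zero ab(1,2)]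
      by (intro mult_left_mono) auto
    finally show ?thesis .
  qed
  have int: "integrable M ?h"
    using Lp_on_integrable[OF f] Lp_on_integrable[OF g] by auto
  have intfg: "integrable M (\<lambda>x. norm (f x + g x) powr p)"
    by (rule Bochner_Integration.integrable_bound[OF int])
       (use f g le in \<open>auto intro: order_trans[OF _ abs_ge_self] dest!: Lp_on_measurable\<close>)
  then show "(\<lambda>x. f x + g x) \<in> Lp_on p M"
    using f g by (auto simp: Lp_on_def)
  have "(\<integral>x. norm (f x + g x) powr p \<partial>M) \<le> (\<integral>x. ?h x \<partial>M)"
    by (intro integral_mono intfg int le)
  also have "\<dots> = (a + b) powr p * (a / (a + b) * ((\<integral>x. norm (f x) powr p \<partial>M) / a powr p)
     + b / (a + b) * ((\<integral>x. norm (g x) powr p \<partial>M) / b powr p))"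
    using Lp_on_integrable[OF f] Lp_on_integrable[OF g] by simp
  also have "\<dots> \<le> (a + b) powr p * (a / (a + b) * 1 + b / (a + b) * 1)"
    using ab p by (intro mult_left_mono add_mono) (auto simp: Lp_on_norm_le_iff)
  also have "\<dots> = (a + b) powr p"
    using ab by (simp add: add_divide_distrib[symmetric])
  finally show "Lp_on_norm p M (\<lambda>x. f x + g x) \<le> a + b"
    using p ab by (simp add: Lp_on_norm_le_iff)
qed

lemma Lp_on_add:
  assumes "1 \<le> p" "f \<in> Lp_on p M" "g \<in> Lp_on p M"
  shows "(\<lambda>x. f x + g x) \<in> Lp_on p M"
    "Lp_on_norm p M (\<lambda>x. f x + g x) \<le> Lp_on_norm p M f + Lp_on_norm p M g"
proof -
  have pos: "0 < Lp_on_norm p M h + e" if "0 < e" for h :: "'a \<Rightarrow> 'b" and e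
    using Lp_on_norm_nonneg[of p M h] that by linarith
  show "(\<lambda>x. f x + g x) \<in> Lp_on p M"
    by (rule Lp_on_add_aux[OF assms pos[of 1 f] pos[of 1 g]]) auto
  show "Lp_on_norm p M (\<lambda>x. f x + g x) \<le> Lp_on_norm p M f + Lp_on_norm p M g"
  proof (rule field_le_epsilon)
    fix e :: real assume "0 < e"
    then have e: "0 < e / 2" by simp
    show "Lp_on_norm p M (\<lambda>x. f x + g x) \<le> Lp_on_norm p M f + Lp_on_norm p M g + e"
      using Lp_on_add_aux(2)[OF assms pos[OF e, of f] pos[OF e, of g]] e by simp
  qed
qed

lemma Lp_on_diff:
  assumes "1 \<le> p" "f \<in> Lp_on p M" "g \<in> Lp_on p M"
  shows "(\<lambda>x. f x - g x) \<in> Lp_on p M"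
    "Lp_on_norm p M (\<lambda>x. f x - g x) \<le> Lp_on_norm p M f + Lp_on_norm p M g"
  using Lp_on_add[OF assms(1,2) Lp_on_scale(1)[OF assms(1,3), of "-1"]]
    Lp_on_scale(2)[OF assms(1,3), of "-1"]
  by auto

lemma Lp_on_norm_triangle:
  assumes "1 \<le> p" "f \<in> Lp_on p M" "g \<in> Lp_on p M" "h \<in> Lp_on p M"
  shows "Lp_on_norm p M (\<lambda>x. f x - h x)
    \<le> Lp_on_norm p M (\<lambda>x. f x - g x) + Lp_on_norm p M (\<lambda>x. g x - h x)"
  using Lp_on_add(2)[OF assms(1) Lp_on_diff(1)[OF assms(1-3)] Lp_on_diff(1)[OF assms(1,3,4)]]
  by simp

lemma Lp_on_norm_minus_commute:
  "Lp_on_norm p M (\<lambda>x. f x - g x) = Lp_on_norm p M (\<lambda>x. g x - f x)"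
  by (simp add: Lp_on_norm_def norm_minus_commute)

text \<open>Here \<open>p < \<infinity>\<close> is essential.\<close>

lemma Lp_on_norm_strict_mono:
  fixes f g :: "'a \<Rightarrow> real"
  assumes p: "1 \<le> p" and g: "g \<in> Lp_on p M" and f: "f \<in> borel_measurable M"
    and le: "AE x in M. 0 \<le> f x" "AE x in M. f x \<le> g x"
    and norm: "Lp_on_norm p M g \<le> Lp_on_norm p M f"
  shows "AE x in M. f x = g x"
proof -
  have f': "f \<in> Lp_on p M"
    by (rule Lp_onI[OF g f]) (use le p in auto)
  have int: "integrable M (\<lambda>x. norm (g x) powr p)" "integrable M (\<lambda>x. norm (f x) powr p)"
    using f' g by (simp_all only: Lp_on_integrable)
  have mono: "AE x in M. 0 \<le> norm (g x) powr p - norm (f x) powr p"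
    using le by eventually_elim (use p in \<open>auto intro: powr_mono2\<close>)
  have "(\<integral>x. norm (g x) powr p \<partial>M) \<le> (\<integral>x. norm (f x) powr p \<partial>M)"
    using powr_mono2[OF _ Lp_on_norm_nonneg norm, of p] p by (simp add: Lp_on_norm_powr)
  then have "(\<integral>x. norm (g x) powr p - norm (f x) powr p \<partial>M) \<le> 0"
    using int by simp
  then have "(\<integral>x. norm (g x) powr p - norm (f x) powr p \<partial>M) = 0"
    using integral_nonneg_AE[OF mono] by simp
  then have "AE x in M. norm (g x) powr p - norm (f x) powr p = 0"
    using int mono by (subst (asm) integral_nonneg_eq_0_iff_AE) auto
  with le show ?thesis
  proof eventually_elim
    case (elim x)
    show ?case
    proof (rule ccontr)
      assume "f x \<noteq> g x"
      then have "f x powr p < g x powr p" using elim p by (intro powr_less_mono2) auto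
      then show False using elim by auto
    qed
  qed
qed

lemma Lp_on_abs:
  fixes f :: "'a \<Rightarrow> real"
  assumes "1 \<le> p" "f \<in> Lp_on p M"
  shows "(\<lambda>x. \<bar>f x\<bar>) \<in> Lp_on p M" "Lp_on_norm p M (\<lambda>x. \<bar>f x\<bar>) = Lp_on_norm p M f"
  using assms by (auto simp: Lp_on_def Lp_on_norm_def)

section \<open>Dominated convergence and common upper bounds\<close>

lemma Lp_on_dominated_convergence:
  fixes f :: "nat \<Rightarrow> 'a \<Rightarrow> real"
  assumes p: "1 \<le> p" and f: "\<And>n. f n \<in> borel_measurable M" and g: "g \<in> Lp_on p M"
    and bound: "\<And>n x. norm (f n x) \<le> norm (g x)" and lim: "\<And>x. (\<lambda>n. f n x) \<longlonglongrightarrow> 0"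
  shows "(\<lambda>n. Lp_on_norm p M (f n)) \<longlonglongrightarrow> 0"
proof -
  have [measurable]: "f n \<in> borel_measurable M" for n by (rule f)
  have "(\<lambda>n. \<integral>x. norm (f n x) powr p \<partial>M) \<longlonglongrightarrow> (\<integral>x. 0 \<partial>M)"
  proof (rule integral_dominated_convergence[where w = "\<lambda>x. norm (g x) powr p"])
    show "AE x in M. (\<lambda>n. norm (f n x) powr p) \<longlonglongrightarrow> 0"
      using lim p by (auto intro!: tendsto_eq_intros AE_I2)
    show "AE x in M. norm (norm (f n x) powr p) \<le> norm (g x) powr p" for n
      using bound p by (auto intro!: powr_mono2)
  qed (use g in \<open>auto intro: Lp_on_integrable\<close>)
  then show ?thesis
    unfolding Lp_on_norm_def using p by (auto intro!: tendsto_eq_intros)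
qed

text \<open>Taking \<open>(\<Sum> f n ^ p) ^ (1 / p)\<close> reduces the claim to countable additivity of the integral.\<close>

lemma Lp_on_upper_bound:
  fixes f :: "nat \<Rightarrow> 'a \<Rightarrow> real"
  assumes p: "1 \<le> p" and f: "\<And>n. f n \<in> Lp_on p M"
    and norm: "\<And>n. Lp_on_norm p M (f n) \<le> (1/2) ^ n"
  obtains F where "F \<in> Lp_on p M" "\<And>n. AE x in M. f n x \<le> F x"
proof -
  have [measurable]: "f n \<in> borel_measurable M" for n using f by (rule Lp_on_measurable)
  define G where "G = (\<lambda>x. \<Sum>n. ennreal (norm (f n x) powr p))"
  have [measurable]: "G \<in> borel_measurable M" unfolding G_def by measurable
  have "(\<integral>\<^sup>+x. G x \<partial>M) = (\<Sum>n. \<integral>\<^sup>+x. ennreal (norm (f n x) powr p) \<partial>M)"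
    unfolding G_def by (rule nn_integral_suminf) measurable
  also have "\<dots> = (\<Sum>n. ennreal (\<integral>x. norm (f n x) powr p \<partial>M))"
    by (intro suminf_cong nn_integral_eq_integral Lp_on_integrable f) auto
  also have "\<dots> \<le> (\<Sum>n. ennreal ((1/2) ^ n))"
  proof (intro suminf_le ennreal_leI)
    fix n
    have "(\<integral>x. norm (f n x) powr p \<partial>M) \<le> ((1/2) ^ n) powr p"
      using norm[of n] p by (simp add: Lp_on_norm_le_iff)
    \<comment> \<open>For a base at most 1 the exponent may be lowered from \<open>p\<close> to 1,
      which leaves a geometric series.\<close>
    also have "\<dots> \<le> ((1/2) ^ n) powr 1"
      using p by (intro powr_mono') (auto simp: power_le_one)
    finally show "(\<integral>x. norm (f n x) powr p \<partial>M) \<le> (1/2) ^ n" by simp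
  qed auto
  also have "\<dots> = ennreal (\<Sum>n. (1/2) ^ n)"
    by (intro suminf_ennreal2) (auto intro: summable_geometric)
  also have "\<dots> < \<infinity>" by simp
  finally have fin: "(\<integral>\<^sup>+x. G x \<partial>M) < \<infinity>" .
  then have finAE: "AE x in M. G x \<noteq> \<infinity>"
    by (intro nn_integral_PInf_AE) auto
  \<comment> \<open>\<open>enn2real\<close> sends infinity to 0, which can spoil the bound only on
    the null set where \<open>G\<close> is infinite.\<close>
  define F where "F = (\<lambda>x. enn2real (G x) powr (1 / p))"
  have [measurable]: "F \<in> borel_measurable M" unfolding F_def by measurable
  have Fp: "norm (F x) powr p = enn2real (G x)" for x
    using p by (simp add: F_def powr_powr)
  have "(\<integral>\<^sup>+x. ennreal (enn2real (G x)) \<partial>M) = (\<integral>\<^sup>+x. G x \<partial>M)"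
    by (intro nn_integral_cong_AE, use finAE in eventually_elim) (simp add: less_top)
  with fin have "integrable M (\<lambda>x. enn2real (G x))"
    by (intro integrableI_nonneg) auto
  then have "F \<in> Lp_on p M" using Fp by (simp add: Lp_on_def del: real_norm_def)
  moreover have "AE x in M. f n x \<le> F x" for n
    using finAE
  proof eventually_elim
    case (elim x)
    have "(\<Sum>k\<in>{n}. ennreal (norm (f k x) powr p)) \<le> G x"
      unfolding G_def by (rule sum_le_suminf) (auto intro: summableI)
    then have "ennreal (norm (f n x) powr p) \<le> G x" by simp
    moreover have "G x < top" using elim by (simp add: less_top)
    ultimately have "enn2real (ennreal (norm (f n x) powr p)) \<le> enn2real (G x)"
      by (rule enn2real_mono)
    then have "norm (f n x) powr p \<le> enn2real (G x)" by simp
    then have "(norm (f n x) powr p) powr (1 / p) \<le> F x"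
      unfolding F_def using p by (intro powr_mono2) auto
    then show "f n x \<le> F x" using p by (simp add: powr_powr)
  qed
  ultimately show ?thesis by (rule that)
qed

lemma Lp_on_norm_le_add_diff:
  assumes "1 \<le> p" "f \<in> Lp_on p M" "g \<in> Lp_on p M"
  shows "Lp_on_norm p M f \<le> Lp_on_norm p M g + Lp_on_norm p M (\<lambda>x. f x - g x)"
  using Lp_on_add(2)[OF assms(1,3) Lp_on_diff(1)[OF assms]] by simp

lemma Lp_on_scale_real:
  fixes f :: "'a \<Rightarrow> real"
  assumes "1 \<le> p" "f \<in> Lp_on p M"
  shows "(\<lambda>x. c * f x) \<in> Lp_on p M" "Lp_on_norm p M (\<lambda>x. c * f x) = \<bar>c\<bar> * Lp_on_norm p M f"
  using Lp_on_scale[OF assms, of c] by simp_all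

section \<open>Passage between real and complex functions\<close>

lemma Lp_eq_Lp_on: "Lp p M = Lp_on p M"
  by (simp add: Lp_def Lp_on_def)

lemma Lp_norm_eq_Lp_on_norm: "Lp_norm p M f = Lp_on_norm p M f"
  by (simp add: Lp_norm_def Lp_on_norm_def)

lemma Lp_on_of_real:
  assumes "f \<in> Lp_on p M"
  shows "(\<lambda>x. complex_of_real (f x)) \<in> Lp_on p M"
    "Lp_on_norm p M (\<lambda>x. complex_of_real (f x)) = Lp_on_norm p M f"
  using assms by (auto simp: Lp_on_def Lp_on_norm_def)

lemma Lp_on_mult:
  fixes f :: "'a \<Rightarrow> complex"
  assumes "1 \<le> p" "f \<in> Lp_on p M"
  shows "(\<lambda>x. c * f x) \<in> Lp_on p M" "Lp_on_norm p M (\<lambda>x. c * f x) = cmod c * Lp_on_norm p M f"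
proof -
  show "(\<lambda>x. c * f x) \<in> Lp_on p M"
    by (rule Lp_onI[OF Lp_on_scale(1)[OF assms, of "cmod c"]])
       (use assms in \<open>auto simp: norm_mult dest: Lp_on_measurable\<close>)
  show "Lp_on_norm p M (\<lambda>x. c * f x) = cmod c * Lp_on_norm p M f"
    using Lp_on_scale(2)[OF assms, of "cmod c"] by (simp add: Lp_on_norm_def norm_mult)
qed

lemma Lp_on_part:
  fixes f :: "'a \<Rightarrow> complex"
  assumes "1 \<le> p" "f \<in> Lp_on p M" "\<rho> \<in> {Re, Im}"
  shows "(\<lambda>x. \<rho> (f x)) \<in> Lp_on p M"
    "Lp_on_norm p M (\<lambda>x. \<rho> (f x)) \<le> Lp_on_norm p M f"
proof -
  have meas: "(\<lambda>x. \<rho> (f x)) \<in> borel_measurable M"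
    using assms(3) Lp_on_measurable[OF assms(2)] by auto
  have le: "AE x in M. norm (\<rho> (f x)) \<le> norm (f x)"
    using assms(3) by (auto simp: abs_Re_le_cmod abs_Im_le_cmod)
  show "(\<lambda>x. \<rho> (f x)) \<in> Lp_on p M"
    by (rule Lp_onI[OF assms(2) meas le]) (use assms(1) in simp)
  show "Lp_on_norm p M (\<lambda>x. \<rho> (f x)) \<le> Lp_on_norm p M f"
    by (rule Lp_on_norm_mono[OF assms(1,2) meas le])
qed

section \<open>Real positive semigroups\<close>

text \<open>Minima are expressed by linear operations and the modulus, so every statement about
  minima below follows from linearity and the corresponding statement about absolute values.\<close>

lemma min_eq_abs: "min a b = (1/2) * ((a + b) - \<bar>a - b\<bar>)" for a b :: real
  by (simp add: min_def)

text \<open>Topology and measure interact only through the last two assumptions: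
  \<open>S_Feller\<close> supplies continuous representatives, and \<open>full_support\<close> turns
  almost everywhere inequalities between continuous functions into inequalities at every
  point.\<close>

locale positive_Feller_semigroup =
  fixes M :: "'a::topological_space measure" and p :: real
    and S :: "real \<Rightarrow> ('a \<Rightarrow> real) \<Rightarrow> 'a \<Rightarrow> real"
  assumes p: "1 \<le> p"
    and S_Lp: "\<And>t f. 0 \<le> t \<Longrightarrow> f \<in> Lp_on p M \<Longrightarrow> S t f \<in> Lp_on p M"
    and S_cong: "\<And>t f g. 0 \<le> t \<Longrightarrow> f \<in> Lp_on p M \<Longrightarrow> g \<in> Lp_on p M \<Longrightarrow>
      AE x in M. f x = g x \<Longrightarrow> AE x in M. S t f x = S t g x"
    and S_add: "\<And>t f g. 0 \<le> t \<Longrightarrow> f \<in> Lp_on p M \<Longrightarrow> g \<in> Lp_on p M \<Longrightarrow>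
      AE x in M. S t (\<lambda>y. f y + g y) x = S t f x + S t g x"
    and S_scale: "\<And>t f c. 0 \<le> t \<Longrightarrow> f \<in> Lp_on p M \<Longrightarrow>
      AE x in M. S t (\<lambda>y. c * f y) x = c * S t f x"
    and S_pos: "\<And>t f. 0 \<le> t \<Longrightarrow> f \<in> Lp_on p M \<Longrightarrow>
      AE x in M. 0 \<le> f x \<Longrightarrow> AE x in M. 0 \<le> S t f x"
    and S_contraction: "\<And>t f. 0 \<le> t \<Longrightarrow> f \<in> Lp_on p M \<Longrightarrow>
      Lp_on_norm p M (S t f) \<le> Lp_on_norm p M f"
    and S_semigroup: "\<And>s t f. 0 \<le> s \<Longrightarrow> 0 \<le> t \<Longrightarrow> f \<in> Lp_on p M \<Longrightarrow>
      AE x in M. S (s + t) f x = S s (S t f) x"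
    and S_zero: "\<And>f. f \<in> Lp_on p M \<Longrightarrow> AE x in M. S 0 f x = f x"
    and S_continuous: "\<And>f. f \<in> Lp_on p M \<Longrightarrow>
      ((\<lambda>t. Lp_on_norm p M (\<lambda>x. S t f x - f x)) \<longlongrightarrow> 0) (at_right 0)"
    and S_Feller: "\<And>f t. f \<in> Lp_on p M \<Longrightarrow> 0 < t \<Longrightarrow>
      \<exists>g. continuous_on UNIV g \<and> (AE x in M. S t f x = g x)"
    and full_support: "\<And>g x. continuous_on UNIV g \<Longrightarrow> AE y in M. 0 \<le> g y \<Longrightarrow> 0 \<le> (g x :: real)"
begin

section \<open>Order and norm estimates for the real semigroup\<close>

abbreviation L where "L \<equiv> Lp_on p M :: ('a \<Rightarrow> real) set"
abbreviation nrm where "nrm \<equiv> Lp_on_norm p M :: ('a \<Rightarrow> real) \<Rightarrow> real"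

lemmas L_add [intro] = Lp_on_add(1)[OF p]
  and L_diff [intro] = Lp_on_diff(1)[OF p]
  and L_scale [intro] = Lp_on_scale_real(1)[OF p]
  and L_abs [intro] = Lp_on_abs(1)[OF p]
  and nrm_triangle = Lp_on_norm_triangle[OF p]

declare S_Lp [intro]

lemma L_measurable: "f \<in> L \<Longrightarrow> f \<in> borel_measurable M"
  by (rule Lp_on_measurable)

lemma L_min [intro]: "f \<in> L \<Longrightarrow> g \<in> L \<Longrightarrow> (\<lambda>x. min (f x) (g x)) \<in> L"
proof -
  assume *: "f \<in> L" "g \<in> L"
  then have "(\<lambda>x. \<bar>f x\<bar> + \<bar>g x\<bar>) \<in> L" by auto
  moreover have "(\<lambda>x. min (f x) (g x)) \<in> borel_measurable M"
    using * by (auto dest!: Lp_on_measurable)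
  ultimately show "(\<lambda>x. min (f x) (g x)) \<in> L"
    by (rule Lp_onI) (use p in auto)
qed

lemma L_zero [intro]: "(\<lambda>x. 0) \<in> L"
  by (simp add: Lp_on_def)

lemma nrm_cong: "f \<in> L \<Longrightarrow> g \<in> L \<Longrightarrow> AE x in M. f x = g x \<Longrightarrow> nrm f = nrm g"
  by (rule Lp_on_norm_cong_AE) (auto dest: Lp_on_measurable)

lemma S_diff:
  assumes "0 \<le> t" "f \<in> L" "g \<in> L"
  shows "AE x in M. S t (\<lambda>y. f y - g y) x = S t f x - S t g x"
  using S_add[OF assms(1,2) L_scale[OF assms(3), of "-1"]] S_scale[OF assms(1,3), of "-1"]
  by eventually_elim simp

lemma S_mono:
  assumes "0 \<le> t" "f \<in> L" "g \<in> L" "AE x in M. f x \<le> g x"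
  shows "AE x in M. S t f x \<le> S t g x"
proof -
  have "AE x in M. 0 \<le> S t (\<lambda>y. g y - f y) x"
    using assms by (intro S_pos) auto
  with S_diff[OF assms(1,3,2)] show ?thesis by eventually_elim simp
qed

lemma nrm_S_diff:
  assumes "0 \<le> t" "f \<in> L" "g \<in> L"
  shows "nrm (\<lambda>x. S t f x - S t g x) \<le> nrm (\<lambda>x. f x - g x)"
proof -
  have "nrm (\<lambda>x. S t f x - S t g x) = nrm (S t (\<lambda>y. f y - g y))"
    using S_diff[OF assms] assms by (intro nrm_cong) auto
  also have "\<dots> \<le> nrm (\<lambda>x. f x - g x)"
    using assms by (intro S_contraction) auto
  finally show ?thesis .
qed

text \<open>Positivity is applied to the two inequalities \<open>f \<le> \<bar>f\<bar>\<close> and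
  \<open>- f \<le> \<bar>f\<bar>\<close>.\<close>

lemma S_abs_le:
  assumes "0 \<le> t" "f \<in> L"
  shows "AE x in M. \<bar>S t f x\<bar> \<le> S t (\<lambda>y. \<bar>f y\<bar>) x"
proof -
  have "AE x in M. S t f x \<le> S t (\<lambda>y. \<bar>f y\<bar>) x" "AE x in M. S t (\<lambda>y. -1 * f y) x \<le> S t (\<lambda>y. \<bar>f y\<bar>) x"
    using assms L_scale[OF assms(2), of "-1"]
    by (intro S_mono L_abs AE_I2; force)+
  with S_scale[OF assms, of "-1"] show ?thesis
    by eventually_elim auto
qed

section \<open>Point evaluation after time 1\<close>

text \<open>The value at \<open>x\<close> of the continuous representative of \<open>S 1 f\<close>.
  For \<open>f\<close> in \<open>L\<close> this representative exists by the Feller property and is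
  unique by full support, so the choice operator leaves no ambiguity. The functional is thus defined
  on classes, although \<open>f\<close> itself has no value at a point.\<close>

definition point_value :: "'a \<Rightarrow> ('a \<Rightarrow> real) \<Rightarrow> real" where
  "point_value x f = (SOME g. continuous_on UNIV g \<and> (AE y in M. S 1 f y = g y)) x"

lemma
  assumes "f \<in> L"
  shows continuous_point_value: "continuous_on UNIV (\<lambda>x. point_value x f)"
    and point_value_AE: "AE x in M. S 1 f x = point_value x f"
  unfolding point_value_def using someI_ex[OF S_Feller[OF assms, of 1]] by auto

text \<open>The difference of the two representatives is continuous and non-negative almost
  everywhere, hence everywhere. Comparing \<open>S 1 f\<close> with \<open>S 1 g\<close>, rather
  than \<open>f\<close> with \<open>g\<close>, is the form to which monotonicity reduces.\<close>

lemma point_value_mono_S: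
  assumes "f \<in> L" "g \<in> L" "AE x in M. S 1 f x \<le> S 1 g x"
  shows "point_value x f \<le> point_value x g"
proof -
  have "0 \<le> point_value x g - point_value x f"
  proof (rule full_support[of "\<lambda>x. point_value x g - point_value x f"])
    show "continuous_on UNIV (\<lambda>x. point_value x g - point_value x f)"
      using assms by (intro continuous_intros continuous_point_value)
    show "AE y in M. 0 \<le> point_value y g - point_value y f"
      using assms(3) point_value_AE[OF assms(1)] point_value_AE[OF assms(2)]
      by eventually_elim simp
  qed
  then show ?thesis by simp
qed

lemma point_value_mono:
  assumes "f \<in> L" "g \<in> L" "AE x in M. f x \<le> g x"
  shows "point_value x f \<le> point_value x g"
  using assms by (intro point_value_mono_S S_mono) auto

lemma point_value_cong:
  assumes "f \<in> L" "g \<in> L" "AE x in M. f x = g x"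
  shows "point_value x f = point_value x g"
proof (rule antisym)
  show "point_value x f \<le> point_value x g"
    by (rule point_value_mono[OF assms(1,2)]) (use assms(3) in eventually_elim, simp)
  show "point_value x g \<le> point_value x f"
    by (rule point_value_mono[OF assms(2,1)]) (use assms(3) in eventually_elim, simp)
qed

text \<open>Full support is used in both directions. This lifts the almost everywhere identities for
  \<open>S 1\<close> to identities for \<open>point_value\<close> at each single point.\<close>

lemma continuous_AE_eq:
  fixes g h :: "'a \<Rightarrow> real"
  assumes "continuous_on UNIV g" "continuous_on UNIV h" "AE y in M. g y = h y"
  shows "g x = h x"
proof -
  have "0 \<le> g x - h x"
    by (rule full_support[of "\<lambda>x. g x - h x"])
       (use assms in \<open>auto intro: continuous_intros elim: eventually_mono\<close>)
  moreover have "0 \<le> h x - g x"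
    by (rule full_support[of "\<lambda>x. h x - g x"])
       (use assms in \<open>auto intro: continuous_intros elim: eventually_mono\<close>)
  ultimately show ?thesis by simp
qed

lemma point_value_scale:
  assumes "f \<in> L"
  shows "point_value x (\<lambda>y. c * f y) = c * point_value x f"
proof (rule continuous_AE_eq[of "\<lambda>x. point_value x (\<lambda>y. c * f y)" "\<lambda>x. c * point_value x f"])
  show "AE x in M. point_value x (\<lambda>y. c * f y) = c * point_value x f"
    using point_value_AE[OF assms] point_value_AE[OF L_scale[OF assms, of c]]
      S_scale[OF zero_le_one assms, of c]
    by eventually_elim simp
qed (use assms in \<open>auto intro!: continuous_intros continuous_point_value\<close>)

lemma point_value_add:
  assumes "f \<in> L" "g \<in> L"
  shows "point_value x (\<lambda>y. f y + g y) = point_value x f + point_value x g"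
proof (rule continuous_AE_eq[of "\<lambda>x. point_value x (\<lambda>y. f y + g y)" "\<lambda>x. point_value x f + point_value x g"])
  show "AE x in M. point_value x (\<lambda>y. f y + g y) = point_value x f + point_value x g"
    using point_value_AE[OF assms(1)] point_value_AE[OF assms(2)] point_value_AE[OF L_add[OF assms]]
      S_add[OF zero_le_one assms]
    by eventually_elim simp
qed (use assms in \<open>auto intro!: continuous_intros continuous_point_value\<close>)

lemma point_value_diff:
  assumes "f \<in> L" "g \<in> L"
  shows "point_value x (\<lambda>y. f y - g y) = point_value x f - point_value x g"
  using point_value_add[OF assms(1) L_scale[OF assms(2), of "-1"], of x]
    point_value_scale[OF assms(2), of x "-1"]
  by simp

lemma point_value_zero: "point_value x (\<lambda>y. 0) = 0"
  using point_value_scale[OF L_zero, of x 0] by simp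

lemma point_value_nonneg: "f \<in> L \<Longrightarrow> AE x in M. 0 \<le> f x \<Longrightarrow> 0 \<le> point_value x f"
  using point_value_mono[OF L_zero, of f x] by (simp add: point_value_zero)

lemma point_value_abs_le:
  assumes "f \<in> L"
  shows "\<bar>point_value x f\<bar> \<le> point_value x (\<lambda>y. \<bar>f y\<bar>)"
  using point_value_mono[OF assms L_abs[OF assms], of x]
    point_value_mono[OF L_scale[OF assms] L_abs[OF assms], of "-1" x]
    point_value_scale[OF assms, of x "-1"]
  by auto

text \<open>A positive functional on a Banach lattice is automatically bounded.\<close>

lemma point_value_bounded:
  obtains C where "0 \<le> C" "\<And>f. f \<in> L \<Longrightarrow> \<bar>point_value x f\<bar> \<le> C * nrm f"
proof (cases "\<exists>C. \<forall>f\<in>L. \<bar>point_value x f\<bar> \<le> C * nrm f")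
  case True
  then obtain C where C: "\<And>f. f \<in> L \<Longrightarrow> \<bar>point_value x f\<bar> \<le> C * nrm f" by blast
  have "\<bar>point_value x f\<bar> \<le> max C 0 * nrm f" if "f \<in> L" for f
    using C[OF that] Lp_on_norm_nonneg[of p M f]
    by (meson max.cobounded1 mult_right_mono order_trans)
  then show ?thesis by (intro that[of "max C 0"]) auto
next
  case False
  have "\<exists>f\<in>L. nrm f \<le> (1/2) ^ n \<and> real n \<le> point_value x f" for n
  proof -
    from False obtain f where f: "f \<in> L" "real n * 2 ^ n * nrm f < \<bar>point_value x f\<bar>"
      by (auto simp: not_le)
    have pos: "0 < nrm f"
    proof (rule ccontr)
      assume "\<not> 0 < nrm f"
      then have "nrm f = 0" using Lp_on_norm_nonneg[of p M f] by simp
      then have "AE x in M. f x = 0" using Lp_on_norm_eq_0_iff[OF p f(1)] by simp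
      then have "point_value x f = 0"
        using point_value_cong[OF f(1) L_zero, of x] by (simp add: point_value_zero)
      with f(2) \<open>nrm f = 0\<close> show False by simp
    qed
    \<comment> \<open>This factor gives \<open>h\<close> the norm \<open>(1/2) ^ n\<close> exactly,
      while the value of \<open>h\<close> is still at least \<open>n\<close>.\<close>
    define c where "c = 1 / (2 ^ n * nrm f)"
    have c: "0 < c" using pos by (simp add: c_def)
    define h where "h = (\<lambda>y. c * \<bar>f y\<bar>)"
    have "h \<in> L" unfolding h_def using f by auto
    moreover have "nrm h \<le> (1/2) ^ n"
      unfolding h_def using pos c f(1)
      by (simp add: Lp_on_scale_real(2)[OF p L_abs] Lp_on_abs(2)[OF p] power_divide)
         (simp add: c_def)
    moreover have "real n \<le> point_value x h"
    proof -
      have "real n = c * (real n * 2 ^ n * nrm f)" using pos by (simp add: c_def)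
      also have "\<dots> \<le> c * point_value x (\<lambda>y. \<bar>f y\<bar>)"
        using f(2) point_value_abs_le[OF f(1), of x] c by (intro mult_left_mono) auto
      also have "\<dots> = point_value x h"
        unfolding h_def using f(1) by (simp add: point_value_scale L_abs)
      finally show ?thesis .
    qed
    ultimately show ?thesis by blast
  qed
  then obtain h where h: "\<And>n. h n \<in> L" "\<And>n. nrm (h n) \<le> (1/2) ^ n"
    "\<And>n. real n \<le> point_value x (h n)" by metis
  \<comment> \<open>One function of \<open>L\<close> dominates all \<open>h n\<close>, so by
    monotonicity its value would exceed every natural number.\<close>
  obtain F where F: "F \<in> L" "\<And>n. AE x in M. h n x \<le> F x"
    using Lp_on_upper_bound[OF p h(1,2)] by metis
  have "real n \<le> point_value x F" for n
    using h(3)[of n] point_value_mono[OF h(1)[of n] F(1) F(2)[of n], of x] by linarith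
  then show ?thesis by (meson reals_Archimedean2 not_le)
qed

lemma point_value_tendsto:
  assumes "\<And>n. f n \<in> L" "g \<in> L" "(\<lambda>n. nrm (\<lambda>x. f n x - g x)) \<longlonglongrightarrow> 0"
  shows "(\<lambda>n. point_value x (f n)) \<longlonglongrightarrow> point_value x g"
proof -
  obtain C where C: "\<And>f. f \<in> L \<Longrightarrow> \<bar>point_value x f\<bar> \<le> C * nrm f"
    using point_value_bounded[of x] by metis
  have "(\<lambda>n. point_value x (f n) - point_value x g) \<longlonglongrightarrow> 0"
  proof (rule Lim_null_comparison)
    show "\<forall>\<^sub>F n in sequentially. norm (point_value x (f n) - point_value x g) \<le> C * nrm (\<lambda>x. f n x - g x)"
      using C[OF L_diff[OF assms(1,2)]] by (simp add: point_value_diff assms)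
    show "(\<lambda>n. C * nrm (\<lambda>x. f n x - g x)) \<longlonglongrightarrow> 0"
      using tendsto_mult_left[OF assms(3), of C] by simp
  qed
  then show ?thesis by (simp add: LIM_zero_iff)
qed

end

section \<open>The recurrent functions as a lattice of isometrically moved functions\<close>

locale recurrent_Feller_semigroup = positive_Feller_semigroup +
  fixes \<tau> :: "nat \<Rightarrow> real"
  assumes \<tau>_nonneg: "\<And>n. 0 \<le> \<tau> n" and \<tau>_at_top: "filterlim \<tau> at_top sequentially"
begin

definition N :: "('a \<Rightarrow> real) set" where
  "N = {f \<in> L. (\<lambda>n. nrm (\<lambda>x. S (\<tau> n) f x - f x)) \<longlonglongrightarrow> 0}"

lemma N_L [intro]: "f \<in> N \<Longrightarrow> f \<in> L" by (simp add: N_def)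

lemma N_lim: "f \<in> N \<Longrightarrow> (\<lambda>n. nrm (\<lambda>x. S (\<tau> n) f x - f x)) \<longlonglongrightarrow> 0"
  by (simp add: N_def)

lemma NI:
  assumes "f \<in> L" "\<And>n. nrm (\<lambda>x. S (\<tau> n) f x - f x) \<le> d n" "d \<longlonglongrightarrow> 0"
  shows "f \<in> N"
proof -
  have "(\<lambda>n. nrm (\<lambda>x. S (\<tau> n) f x - f x)) \<longlonglongrightarrow> 0"
    by (rule Lim_null_comparison[OF _ assms(3)]) (simp add: assms(2) Lp_on_norm_nonneg)
  then show ?thesis using assms(1) by (simp add: N_def)
qed

lemma N_add [intro]:
  assumes "f \<in> N" "g \<in> N"
  shows "(\<lambda>x. f x + g x) \<in> N"
proof (rule NI)
  fix n
  have "nrm (\<lambda>x. S (\<tau> n) (\<lambda>x. f x + g x) x - (f x + g x))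
      = nrm (\<lambda>x. (S (\<tau> n) f x - f x) + (S (\<tau> n) g x - g x))"
    using S_add[OF \<tau>_nonneg[of n] N_L N_L, OF assms] assms \<tau>_nonneg
    by (intro nrm_cong L_diff L_add S_Lp N_L) (auto elim: eventually_mono)
  also have "\<dots> \<le> nrm (\<lambda>x. S (\<tau> n) f x - f x) + nrm (\<lambda>x. S (\<tau> n) g x - g x)"
    using assms \<tau>_nonneg by (intro Lp_on_add(2)[OF p] L_diff S_Lp N_L)
  finally show "nrm (\<lambda>x. S (\<tau> n) (\<lambda>x. f x + g x) x - (f x + g x))
    \<le> nrm (\<lambda>x. S (\<tau> n) f x - f x) + nrm (\<lambda>x. S (\<tau> n) g x - g x)" .
qed (use assms tendsto_add[OF N_lim N_lim] in auto)

lemma N_scale [intro]: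
  assumes "f \<in> N"
  shows "(\<lambda>x. c * f x) \<in> N"
proof (rule NI)
  fix n
  have "nrm (\<lambda>x. S (\<tau> n) (\<lambda>x. c * f x) x - c * f x) = nrm (\<lambda>x. c * (S (\<tau> n) f x - f x))"
    using S_scale[OF \<tau>_nonneg[of n] N_L, OF assms, of c] assms \<tau>_nonneg
    by (intro nrm_cong L_diff L_scale S_Lp N_L) (auto elim!: eventually_mono simp: algebra_simps)
  also have "\<dots> = \<bar>c\<bar> * nrm (\<lambda>x. S (\<tau> n) f x - f x)"
    using assms \<tau>_nonneg by (intro Lp_on_scale_real(2)[OF p] L_diff S_Lp N_L)
  finally show "nrm (\<lambda>x. S (\<tau> n) (\<lambda>x. c * f x) x - c * f x) \<le> \<bar>c\<bar> * nrm (\<lambda>x. S (\<tau> n) f x - f x)"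
    by simp
  show "(\<lambda>n. \<bar>c\<bar> * nrm (\<lambda>x. S (\<tau> n) f x - f x)) \<longlonglongrightarrow> 0"
    using tendsto_mult_left[OF N_lim[OF assms], of "\<bar>c\<bar>"] by simp
qed (use assms in auto)

lemma N_diff [intro]: "f \<in> N \<Longrightarrow> g \<in> N \<Longrightarrow> (\<lambda>x. f x - g x) \<in> N"
  using N_add[of f "\<lambda>x. -1 * g x"] N_scale[of g "-1"] by simp

text \<open>\<open>S t\<close> commutes with \<open>S (\<tau> n)\<close> and, being a contraction,
  does not increase the distance from \<open>S (\<tau> n) f\<close> to \<open>f\<close>.\<close>

lemma N_S [intro]:
  assumes "f \<in> N" "0 \<le> t"
  shows "S t f \<in> N"
proof (rule NI[OF _ _ N_lim[OF assms(1)]])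
  fix n
  have f: "f \<in> L" using assms by auto
  have "AE x in M. S (\<tau> n) (S t f) x - S t f x = S t (S (\<tau> n) f) x - S t f x"
    using S_semigroup[OF \<tau>_nonneg[of n] assms(2) f] S_semigroup[OF assms(2) \<tau>_nonneg[of n] f]
    by eventually_elim (simp add: add.commute)
  then have "nrm (\<lambda>x. S (\<tau> n) (S t f) x - S t f x) = nrm (\<lambda>x. S t (S (\<tau> n) f) x - S t f x)"
    using assms \<tau>_nonneg by (intro nrm_cong L_diff S_Lp N_L)
  also have "\<dots> \<le> nrm (\<lambda>x. S (\<tau> n) f x - f x)"
    using assms \<tau>_nonneg by (intro nrm_S_diff S_Lp N_L)
  finally show "nrm (\<lambda>x. S (\<tau> n) (S t f) x - S t f x) \<le> nrm (\<lambda>x. S (\<tau> n) f x - f x)" .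
qed (use assms in auto)

text \<open>As soon as \<open>t \<le> \<tau> n\<close>, the function \<open>S (\<tau> n) f\<close>
  is a contracted image of \<open>S t f\<close>. Its norm tends to that of \<open>f\<close>, so
  \<open>S t\<close> cannot have lost any norm.\<close>

lemma S_isometric:
  assumes "f \<in> N" "0 \<le> t"
  shows "nrm (S t f) = nrm f"
proof (rule antisym)
  show "nrm (S t f) \<le> nrm f" using assms by (intro S_contraction) auto
  have f: "f \<in> L" using assms by auto
  have "(\<lambda>n. nrm (S t f) + nrm (\<lambda>x. S (\<tau> n) f x - f x)) \<longlonglongrightarrow> nrm (S t f) + 0"
    using N_lim[OF assms(1)] by (intro tendsto_intros)
  moreover have "\<forall>\<^sub>F n in sequentially. nrm f \<le> nrm (S t f) + nrm (\<lambda>x. S (\<tau> n) f x - f x)"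
  proof -
    have "\<forall>\<^sub>F n in sequentially. t \<le> \<tau> n"
      using \<tau>_at_top by (simp add: filterlim_at_top)
    then show ?thesis
    proof eventually_elim
      case (elim n)
      have "nrm f \<le> nrm (S (\<tau> n) f) + nrm (\<lambda>x. S (\<tau> n) f x - f x)"
        using Lp_on_norm_le_add_diff[OF p f S_Lp[OF \<tau>_nonneg[of n] f]]
        by (simp add: Lp_on_norm_minus_commute)
      also have "nrm (S (\<tau> n) f) = nrm (S (\<tau> n - t) (S t f))"
        using S_semigroup[of "\<tau> n - t" t f] elim assms(2) f \<tau>_nonneg[of n]
        by (intro nrm_cong) auto
      also have "\<dots> \<le> nrm (S t f)"
        using elim assms(2) f by (intro S_contraction) auto
      finally show ?case by simp
    qed
  qed
  ultimately show "nrm f \<le> nrm (S t f)"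
    using tendsto_lowerbound by fastforce
qed

text \<open>The right side dominates the left, yet its norm is at most \<open>nrm f\<close>, which
  is the norm of the left side by isometry. Strict monotonicity of the norm leaves only
  equality.\<close>

lemma S_abs:
  assumes "f \<in> N" "0 \<le> t"
  shows "AE x in M. \<bar>S t f x\<bar> = S t (\<lambda>y. \<bar>f y\<bar>) x"
proof (rule Lp_on_norm_strict_mono[OF p])
  have f: "f \<in> L" using assms by auto
  show "S t (\<lambda>y. \<bar>f y\<bar>) \<in> L" using f assms by auto
  show "(\<lambda>x. \<bar>S t f x\<bar>) \<in> borel_measurable M"
    using f assms by (intro Lp_on_measurable[of _ p] L_abs S_Lp)
  show "AE x in M. \<bar>S t f x\<bar> \<le> S t (\<lambda>y. \<bar>f y\<bar>) x" by (rule S_abs_le[OF assms(2) f])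
  have "nrm (S t (\<lambda>y. \<bar>f y\<bar>)) \<le> nrm (\<lambda>y. \<bar>f y\<bar>)"
    using f assms by (intro S_contraction) auto
  also have "\<dots> = nrm (\<lambda>x. \<bar>S t f x\<bar>)"
    using Lp_on_abs(2)[OF p f] Lp_on_abs(2)[OF p S_Lp[OF assms(2) f]] S_isometric[OF assms] by simp
  finally show "nrm (S t (\<lambda>y. \<bar>f y\<bar>)) \<le> nrm (\<lambda>x. \<bar>S t f x\<bar>)" .
qed auto

text \<open>Since \<open>S (\<tau> n)\<close> commutes with the modulus on \<open>N\<close>, the
  reverse triangle inequality bounds the defect of \<open>\<bar>f\<bar>\<close> pointwise by that of
  \<open>f\<close>.\<close>

lemma N_abs [intro]:
  assumes "f \<in> N"
  shows "(\<lambda>x. \<bar>f x\<bar>) \<in> N"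
proof (rule NI[OF _ _ N_lim[OF assms]])
  fix n
  have f: "f \<in> L" using assms by auto
  show "nrm (\<lambda>x. S (\<tau> n) (\<lambda>x. \<bar>f x\<bar>) x - \<bar>f x\<bar>) \<le> nrm (\<lambda>x. S (\<tau> n) f x - f x)"
  proof (rule Lp_on_norm_mono[OF p])
    show "AE x in M. norm (S (\<tau> n) (\<lambda>x. \<bar>f x\<bar>) x - \<bar>f x\<bar>) \<le> norm (S (\<tau> n) f x - f x)"
      using S_abs[OF assms \<tau>_nonneg[of n]] by eventually_elim auto
    show "(\<lambda>x. S (\<tau> n) (\<lambda>x. \<bar>f x\<bar>) x - \<bar>f x\<bar>) \<in> borel_measurable M"
      using f \<tau>_nonneg by (intro Lp_on_measurable[of _ p] L_diff L_abs S_Lp)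
  qed (use f \<tau>_nonneg in auto)
qed (use assms in auto)

lemma N_min [intro]: "f \<in> N \<Longrightarrow> g \<in> N \<Longrightarrow> (\<lambda>x. min (f x) (g x)) \<in> N"
  unfolding min_eq_abs by (intro N_scale N_diff N_add N_abs)

text \<open>\<open>S_abs\<close> at time 1 equates two continuous functions almost everywhere, hence
  at \<open>x\<close>.\<close>

lemma point_value_abs:
  assumes "f \<in> N"
  shows "point_value x (\<lambda>y. \<bar>f y\<bar>) = \<bar>point_value x f\<bar>"
proof (rule continuous_AE_eq[of "\<lambda>x. point_value x (\<lambda>y. \<bar>f y\<bar>)" "\<lambda>x. \<bar>point_value x f\<bar>"])
  show "AE x in M. point_value x (\<lambda>y. \<bar>f y\<bar>) = \<bar>point_value x f\<bar>"
    using point_value_AE[OF N_L, OF assms] point_value_AE[OF N_L, OF N_abs, OF assms]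
      S_abs[OF assms zero_le_one]
    by eventually_elim simp
qed (use assms in \<open>auto intro!: continuous_intros continuous_point_value\<close>)

lemma point_value_min:
  assumes "f \<in> N" "g \<in> N"
  shows "point_value x (\<lambda>y. min (f y) (g y)) = min (point_value x f) (point_value x g)"
proof -
  have "point_value x (\<lambda>y. (1/2) * ((f y + g y) - \<bar>f y - g y\<bar>))
      = (1/2) * point_value x (\<lambda>y. (f y + g y) - \<bar>f y - g y\<bar>)"
    using assms by (intro point_value_scale L_diff L_add L_abs N_L)
  also have "point_value x (\<lambda>y. (f y + g y) - \<bar>f y - g y\<bar>)
      = point_value x (\<lambda>y. f y + g y) - point_value x (\<lambda>y. \<bar>f y - g y\<bar>)"
    using assms by (intro point_value_diff L_diff L_add L_abs N_L)
  also have "point_value x (\<lambda>y. f y + g y) = point_value x f + point_value x g"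
    using assms by (intro point_value_add N_L)
  also have "point_value x (\<lambda>y. \<bar>f y - g y\<bar>) = \<bar>point_value x (\<lambda>y. f y - g y)\<bar>"
    using assms by (intro point_value_abs N_diff)
  also have "point_value x (\<lambda>y. f y - g y) = point_value x f - point_value x g"
    using assms by (intro point_value_diff N_L)
  finally show ?thesis unfolding min_eq_abs .
qed

lemma S_min:
  assumes f: "f \<in> N" and g: "g \<in> N" and t: "0 \<le> t"
  shows "AE x in M. S t (\<lambda>y. min (f y) (g y)) x = min (S t f x) (S t g x)"
proof -
  note fg = N_L[OF f] N_L[OF g]
  note d = N_diff[OF f g]
  note fg' = L_add[OF fg] L_abs[OF N_L[OF d]]
  show ?thesis
    unfolding min_eq_abs
    using S_scale[OF t L_diff[OF fg'], of "1/2"] S_diff[OF t fg'] S_add[OF t fg] S_abs[OF d t]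
      S_diff[OF t fg]
    by eventually_elim simp
qed

section \<open>Closedness and least elements with a prescribed value\<close>

text \<open>Contractivity makes the approximation of \<open>S (\<tau> n) g\<close> by
  \<open>S (\<tau> n) (f k)\<close> uniform in \<open>n\<close>, so a three-term estimate with one
  fixed \<open>k\<close> suffices.\<close>

lemma N_closed:
  assumes f: "\<And>n. f n \<in> N" and g: "g \<in> L" and lim: "(\<lambda>n. nrm (\<lambda>x. f n x - g x)) \<longlonglongrightarrow> 0"
  shows "g \<in> N"
proof -
  have "(\<lambda>n. nrm (\<lambda>x. S (\<tau> n) g x - g x)) \<longlonglongrightarrow> 0"
  proof (rule LIMSEQ_I)
    fix r :: real assume r: "0 < r"
    then obtain k where k: "nrm (\<lambda>x. f k x - g x) < r / 3"
      using LIMSEQ_D[OF lim, of "r / 3"] by (auto simp: Lp_on_norm_nonneg)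
    have fk: "f k \<in> L" using f by auto
    have "\<forall>\<^sub>F n in sequentially. nrm (\<lambda>x. S (\<tau> n) (f k) x - f k x) < r / 3"
      using order_tendstoD(2)[OF N_lim[OF f[of k]], of "r / 3"] r by simp
    then have "\<forall>\<^sub>F n in sequentially. nrm (\<lambda>x. S (\<tau> n) g x - g x) < r"
    proof eventually_elim
      case (elim n)
      have "nrm (\<lambda>x. S (\<tau> n) g x - g x)
        \<le> nrm (\<lambda>x. S (\<tau> n) g x - S (\<tau> n) (f k) x) + nrm (\<lambda>x. S (\<tau> n) (f k) x - g x)"
        using fk g \<tau>_nonneg by (intro nrm_triangle S_Lp)
      also have "nrm (\<lambda>x. S (\<tau> n) (f k) x - g x)
        \<le> nrm (\<lambda>x. S (\<tau> n) (f k) x - f k x) + nrm (\<lambda>x. f k x - g x)"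
        using fk g \<tau>_nonneg by (intro nrm_triangle S_Lp)
      also have "nrm (\<lambda>x. S (\<tau> n) g x - S (\<tau> n) (f k) x) \<le> nrm (\<lambda>x. f k x - g x)"
        using nrm_S_diff[OF \<tau>_nonneg[of n] g fk] by (simp add: Lp_on_norm_minus_commute)
      finally show ?case using elim k by simp
    qed
    then show "\<exists>n0. \<forall>n\<ge>n0. norm (nrm (\<lambda>x. S (\<tau> n) g x - g x) - 0) < r"
      by (simp add: eventually_sequentially Lp_on_norm_nonneg)
  qed
  with g show ?thesis by (simp add: N_def)
qed

text \<open>The least element is found by minimizing the norm: running minima of a minimizing
  sequence decrease to a function \<open>e\<close> that attains the infimum. No admissible function
  can then cut off a non-null part of \<open>e\<close>, since the minimum of the two would be
  admissible with smaller norm.\<close>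

lemma minimal_with_point_value:
  assumes g: "g \<in> N" "AE y in M. 0 \<le> g y"
  obtains e where "e \<in> N" "\<And>y. 0 \<le> e y" "point_value x e = point_value x g"
    "\<And>f. f \<in> N \<Longrightarrow> AE y in M. 0 \<le> f y \<Longrightarrow> point_value x f = point_value x g \<Longrightarrow>
      AE y in M. e y \<le> f y"
proof -
  \<comment> \<open>Non-negativity is required at every point, so that the decreasing sequence below
    converges everywhere. \<open>abs_A\<close> brings functions that are non-negative almost
    everywhere into this set.\<close>
  define A where "A = {f \<in> N. (\<forall>y. 0 \<le> f y) \<and> point_value x f = point_value x g}"
  have abs_A: "(\<lambda>y. \<bar>f y\<bar>) \<in> A"
    if "f \<in> N" "AE y in M. 0 \<le> f y" "point_value x f = point_value x g" for f
  proof -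
    have "AE y in M. \<bar>f y\<bar> = f y" using that(2) by eventually_elim simp
    then have "point_value x (\<lambda>y. \<bar>f y\<bar>) = point_value x f"
      using that(1) by (intro point_value_cong) auto
    then show ?thesis using that by (auto simp: A_def)
  qed
  have min_A: "(\<lambda>y. min (f y) (h y)) \<in> A" if "f \<in> A" "h \<in> A" for f h
    using that by (auto simp: A_def point_value_min)
  define I where "I = Inf (nrm ` A)"
  have bdd: "bdd_below (nrm ` A)"
    by (rule bdd_belowI[of _ 0]) (auto simp: Lp_on_norm_nonneg)
  have I_le: "I \<le> nrm f" if "f \<in> A" for f
    unfolding I_def using that bdd by (intro cInf_lower) auto
  have "\<exists>f\<in>A. nrm f < I + inverse (real (Suc n))" for n
  proof -
    have "Inf (nrm ` A) < I + inverse (real (Suc n))" by (simp add: I_def)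
    then show ?thesis
      using cInf_less_iff[of "nrm ` A"] bdd abs_A[OF g] by auto
  qed
  then obtain f where f: "\<And>n. f n \<in> A" "\<And>n. nrm (f n) < I + inverse (real (Suc n))" by metis
  \<comment> \<open>\<open>E n\<close> is the minimum of \<open>f 0\<close>, ...,
    \<open>f n\<close>. It stays in \<open>A\<close> because the functional respects minima on
    \<open>N\<close>.\<close>
  define E where "E = rec_nat (f 0) (\<lambda>n h y. min (h y) (f (Suc n) y))"
  have E_0: "E 0 = f 0" and E_Suc: "E (Suc n) = (\<lambda>y. min (E n y) (f (Suc n) y))" for n
    by (simp_all add: E_def)
  have E_A: "E n \<in> A" for n
    by (induction n) (simp_all add: E_0 E_Suc f min_A)
  have E_le: "E n y \<le> f n y" for n y
    by (cases n) (simp_all add: E_0 E_Suc)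
  have E_nonneg: "0 \<le> E n y" for n y using E_A by (simp add: A_def)
  have E_N: "E n \<in> N" for n using E_A by (simp add: A_def)
  have dec: "decseq (\<lambda>n. E n y)" for y
    by (rule decseq_SucI) (simp add: E_Suc)
  define e where "e y = lim (\<lambda>n. E n y)" for y
  have lim: "(\<lambda>n. E n y) \<longlonglongrightarrow> e y" for y
  proof -
    have "convergent (\<lambda>n. E n y)"
      using decseq_convergent[OF dec, of 0] E_nonneg by (metis convergentI)
    then show ?thesis by (simp add: e_def convergent_LIMSEQ_iff)
  qed
  have e_nonneg: "0 \<le> e y" for y
    using LIMSEQ_le_const[OF lim] E_nonneg by blast
  have e_le: "e y \<le> E n y" for n y
    using decseq_ge[OF dec lim] .
  have E_le_0: "E n y \<le> E 0 y" for n y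
    using decseqD[OF dec] by blast
  have e_meas: "e \<in> borel_measurable M"
    by (rule borel_measurable_LIMSEQ_real[OF lim]) (use E_N in \<open>auto intro: L_measurable\<close>)
  have e_L: "e \<in> L"
    by (rule Lp_onI[OF N_L[OF E_N[of 0]] e_meas]) (use e_nonneg e_le p E_nonneg in auto)
  have conv: "(\<lambda>n. nrm (\<lambda>y. E n y - e y)) \<longlonglongrightarrow> 0"
  proof (rule Lp_on_dominated_convergence[OF p _ N_L[OF E_N[of 0]]])
    show "(\<lambda>y. E n y - e y) \<in> borel_measurable M" for n
      using E_N e_L by (intro Lp_on_measurable[of _ p] L_diff) auto
    show "norm (E n y - e y) \<le> norm (E 0 y)" for n y
      using e_nonneg[of y] e_le[of y n] E_le_0[of n y] by simp
    show "(\<lambda>n. E n y - e y) \<longlonglongrightarrow> 0" for y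
      using lim[of y] by (simp add: LIM_zero_iff)
  qed
  have e_N: "e \<in> N" by (rule N_closed[OF E_N e_L conv])
  \<comment> \<open>Boundedness of the functional carries the prescribed value over to the
    limit.\<close>
  have "(\<lambda>n. point_value x (E n)) \<longlonglongrightarrow> point_value x e"
    by (rule point_value_tendsto[OF N_L[OF E_N] e_L conv])
  then have e_val: "point_value x e = point_value x g"
    using E_A by (simp add: A_def LIMSEQ_const_iff)
  have "nrm e \<le> I + inverse (real (Suc n))" for n
  proof -
    have "nrm e \<le> nrm (f n)"
      using f(1)[of n] e_meas e_nonneg order_trans[OF e_le E_le]
      by (intro Lp_on_norm_mono[OF p]) (auto simp: A_def)
    then show ?thesis using f(2)[of n] by simp
  qed
  then have norm_e: "nrm e \<le> I"
    using LIMSEQ_inverse_real_of_nat_add[of I] by (auto intro: LIMSEQ_le_const)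
  show ?thesis
  proof (rule that[OF e_N e_nonneg e_val])
    fix h assume h: "h \<in> N" "AE y in M. 0 \<le> h y" "point_value x h = point_value x g"
    have m_A: "(\<lambda>y. min (e y) \<bar>h y\<bar>) \<in> A"
      using abs_A[OF h] e_N e_nonneg e_val by (intro min_A) (auto simp: A_def)
    then have m_N: "(\<lambda>y. min (e y) \<bar>h y\<bar>) \<in> N" by (simp add: A_def)
    \<comment> \<open>The minimum lies in \<open>A\<close> and below \<open>e\<close>, while its
      norm is at least \<open>I \<ge> nrm e\<close>; strict monotonicity applies.\<close>
    have "AE y in M. min (e y) \<bar>h y\<bar> = e y"
      by (rule Lp_on_norm_strict_mono[OF p e_L])
         (use I_le[OF m_A] norm_e m_N e_nonneg in \<open>auto intro: L_measurable\<close>)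
    with h(2) show "AE y in M. e y \<le> h y" by eventually_elim (auto simp: min_def split: if_splits)
  qed
qed

section \<open>Invariance of the least element\<close>

lemma S_multiple:
  assumes e: "e \<in> L" and s: "0 \<le> s" "AE y in M. S s e y = e y"
  shows "AE y in M. S (real n * s) e y = e y"
proof (induction n)
  case 0
  show ?case using S_zero[OF e] by simp
next
  case (Suc n)
  have "AE y in M. S (s + real n * s) e y = S s (S (real n * s) e) y"
    using s e by (intro S_semigroup) auto
  moreover have "AE y in M. S s (S (real n * s) e) y = S s e y"
    using s e Suc by (intro S_cong) auto
  ultimately show ?case
    using s(2) by eventually_elim (simp add: algebra_simps)
qed

text \<open>The number \<open>l t\<close> measures how much of \<open>e\<close> survives in
  \<open>S t e\<close> at \<open>x\<close>. Isometry gives \<open>l t \<le> 1\<close>, recurrence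
  gives \<open>l (\<tau> n) \<longlonglongrightarrow> 1\<close>, and multiplicativity excludes any
  loss at a small time \<open>s\<close>. Iterating \<open>S s\<close> then reaches all
  times.\<close>

lemma minimal_invariant:
  assumes e: "e \<in> N" "\<And>y. 0 \<le> e y" "0 < point_value x e"
    and minimal: "\<And>f. f \<in> N \<Longrightarrow> AE y in M. 0 \<le> f y \<Longrightarrow> point_value x f = point_value x e \<Longrightarrow>
      AE y in M. e y \<le> f y"
    and s: "0 \<le> s"
  shows "AE y in M. S s e y = e y"
proof -
  define v where "v = point_value x e"
  define l where "l t = point_value x (S t e) / v" for t
  have v: "0 < v" using e by (simp add: v_def)
  have e_L: "e \<in> L" using e by auto
  have S_e_N: "S t e \<in> N" if "0 \<le> t" for t using that e by auto
  have S_e_nonneg: "AE y in M. 0 \<le> S t e y" if "0 \<le> t" for t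
    using that e e_L by (intro S_pos) auto
  have val_S: "point_value x (S t e) = l t * v" for t
    using v by (simp add: l_def)
  have l_nonneg: "0 \<le> l t" if "0 \<le> t" for t
    using v point_value_nonneg[OF N_L[OF S_e_N[OF that]] S_e_nonneg[OF that], of x] by (simp add: l_def)
  have l_le: "AE y in M. l t * e y \<le> S t e y" if t: "0 \<le> t" for t
  proof (cases "l t = 0")
    case True
    then show ?thesis using S_e_nonneg[OF t] by simp
  next
    case False
    then have pos: "0 < l t" using l_nonneg[OF t] by simp
    \<comment> \<open>After division by \<open>l t\<close> the function \<open>S t e\<close> has the
      same value at \<open>x\<close> as \<open>e\<close>, so minimality applies to it.\<close>
    have "AE y in M. e y \<le> (1 / l t) * S t e y"
    proof (rule minimal)
      show "(\<lambda>y. 1 / l t * S t e y) \<in> N" using S_e_N[OF t] by (rule N_scale)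
      show "AE y in M. 0 \<le> 1 / l t * S t e y"
        using S_e_nonneg[OF t] by eventually_elim (use pos in simp)
      show "point_value x (\<lambda>y. 1 / l t * S t e y) = point_value x e"
        using pos unfolding point_value_scale[OF N_L[OF S_e_N[OF t]]] val_S by (simp add: v_def)
    qed
    then show ?thesis by eventually_elim (use pos in \<open>simp add: field_simps\<close>)
  qed
  have nrm_e: "0 < nrm e"
  proof (rule ccontr)
    assume "\<not> 0 < nrm e"
    then have "AE y in M. e y = 0"
      using Lp_on_norm_nonneg[of p M e] Lp_on_norm_eq_0_iff[OF p e_L] by simp
    then have "point_value x e = 0"
      using point_value_cong[OF e_L L_zero, of x] by (simp add: point_value_zero)
    then show False using e by simp
  qed
  have l_le_1: "l t \<le> 1" if t: "0 \<le> t" for t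
  proof -
    have "l t * nrm e = nrm (\<lambda>y. l t * e y)"
      using Lp_on_scale_real(2)[OF p e_L, of "l t"] l_nonneg[OF t] by simp
    also have "\<dots> \<le> nrm (S t e)"
    proof (rule Lp_on_norm_mono[OF p])
      show "AE y in M. norm (l t * e y) \<le> norm (S t e y)"
        using l_le[OF t] by eventually_elim (use l_nonneg[OF t] e(2) in \<open>auto simp: abs_mult\<close>)
    qed (use e_L t in \<open>auto intro: L_measurable\<close>)
    also have "\<dots> = 1 * nrm e" using S_isometric[OF e(1) t] by simp
    finally show ?thesis using nrm_e by simp
  qed
  text \<open>The remainder \<open>S t e - l t * e\<close> is disjoint from \<open>e\<close>, and lattice homomorphisms
    preserve disjointness.\<close>
  have l_mult: "l (u + t) = l t * l u" if t: "0 \<le> t" and u: "0 \<le> u" and pos: "0 < l u" for t u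
  proof -
    define q where "q = (\<lambda>y. S t e y - l t * e y)"
    have q_N: "q \<in> N" unfolding q_def using S_e_N[OF t] e by auto
    have q_nonneg: "AE y in M. 0 \<le> q y"
      using l_le[OF t] by eventually_elim (simp add: q_def)
    have q_val: "point_value x q = 0"
      unfolding q_def using S_e_N[OF t] e_L
      by (simp add: point_value_diff point_value_scale N_L L_scale val_S) (simp add: v_def)
    define m where "m = (\<lambda>y. min (q y) (e y))"
    have m_N: "m \<in> N" unfolding m_def using q_N e by auto
    \<comment> \<open>The functional respects minima, so \<open>m\<close> has value
      \<open>min 0 v = 0\<close> and subtracting it preserves the value of \<open>e\<close>.
      Minimality then gives \<open>m \<le> 0\<close>, whereas \<open>m\<close> is a minimum of
      non-negative functions.\<close>
    have "AE y in M. e y \<le> e y - m y"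
    proof (rule minimal)
      show "(\<lambda>y. e y - m y) \<in> N" using e m_N by auto
      show "AE y in M. 0 \<le> e y - m y" by (simp add: m_def)
      have "point_value x m = 0"
        unfolding m_def using point_value_min[OF q_N e(1), of x] q_val e by simp
      then show "point_value x (\<lambda>y. e y - m y) = point_value x e"
        using e_L m_N by (simp add: point_value_diff N_L)
    qed
    with q_nonneg have "AE y in M. m y = 0"
    proof eventually_elim
      case (elim y)
      then show ?case using e(2)[of y] by (auto simp: m_def)
    qed
    then have "AE y in M. S u m y = S u (\<lambda>y. 0 * e y) y"
      using u m_N e_L by (intro S_cong) auto
    with S_scale[OF u e_L, of 0] S_min[OF q_N e(1) u]
    have "AE y in M. min (S u q y) (S u e y) = 0"
      by eventually_elim (simp add: m_def)
    then have "point_value x (\<lambda>y. min (S u q y) (S u e y)) = point_value x (\<lambda>y. 0)"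
      using u q_N S_e_N[OF u] by (intro point_value_cong) auto
    then have "min (point_value x (S u q)) (l u * v) = 0"
      using u q_N S_e_N[OF u] by (simp add: point_value_min N_S val_S point_value_zero)
    moreover have "0 < l u * v" using pos v by simp
    \<comment> \<open>A minimum of two numbers is 0 while the second is positive; this is where
      \<open>0 < l u\<close> enters.\<close>
    ultimately have Sq_val: "point_value x (S u q) = 0" by (simp add: min_def split: if_splits)
    have "AE y in M. S (u + t) e y = S u (S t e) y"
      using u t e_L by (rule S_semigroup)
    moreover have "AE y in M. S u q y = S u (S t e) y - S u (\<lambda>y. l t * e y) y"
      unfolding q_def using u t e_L by (intro S_diff) auto
    ultimately have "AE y in M. S (u + t) e y = S u q y + l t * S u e y"
      using S_scale[OF u e_L, of "l t"] by eventually_elim simp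
    then have "point_value x (S (u + t) e) = point_value x (\<lambda>y. S u q y + l t * S u e y)"
      using u t e(1) q_N by (intro point_value_cong L_add L_scale S_Lp N_L) auto
    also have "\<dots> = l t * (l u * v)"
      using u e_L q_N by (simp add: point_value_add point_value_scale N_L S_Lp L_scale Sq_val val_S)
    finally show ?thesis using v by (simp add: val_S)
  qed
  obtain c where c: "0 \<le> c" "\<And>f. f \<in> L \<Longrightarrow> \<bar>point_value x f\<bar> \<le> c * nrm f"
    using point_value_bounded[of x] by metis
  \<comment> \<open>The size is chosen so that \<open>c * (2 * d) < v\<close>: a function of
    \<open>L\<close> within \<open>2 * d\<close> of \<open>e\<close> then has a positive value at
    \<open>x\<close>. The summand 1 keeps the denominator positive even if
    \<open>c = 0\<close>.\<close>
  define d where "d = v / (2 * (c + 1))"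
  have d: "0 < d" using v c by (simp add: d_def)
  have l_tau: "(\<lambda>n. l (\<tau> n)) \<longlonglongrightarrow> 1"
  proof -
    have "(\<lambda>n. point_value x (S (\<tau> n) e)) \<longlonglongrightarrow> v"
      unfolding v_def using e_L \<tau>_nonneg N_lim[OF e(1)] by (intro point_value_tendsto) auto
    from tendsto_divide[OF this tendsto_const[of v]] show ?thesis
      using v by (simp add: l_def)
  qed
  have small: "AE y in M. S s e y = e y" if s: "0 < s" "nrm (\<lambda>y. S s e y - e y) < d" for s
  proof -
    have "\<forall>\<^sub>F n in sequentially. s \<le> \<tau> n"
      using \<tau>_at_top by (simp add: filterlim_at_top)
    moreover have "\<forall>\<^sub>F n in sequentially. nrm (\<lambda>y. S (\<tau> n) e y - e y) < d"
      using order_tendstoD(2)[OF N_lim[OF e(1)] d] .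
    ultimately have "\<forall>\<^sub>F n in sequentially. l (\<tau> n) \<le> l s"
    proof eventually_elim
      case (elim n)
      let ?u = "\<tau> n - s"
      have u: "0 \<le> ?u" using elim by simp
      \<comment> \<open>\<open>S ?u e\<close> is compared with \<open>e\<close> through
        \<open>S (\<tau> n) e = S ?u (S s e)\<close>: one distance is small by contraction and
        smallness of \<open>s\<close>, the other by recurrence. This secures
        \<open>0 < l ?u\<close>, as \<open>l_mult\<close> requires.\<close>
      have "nrm (\<lambda>y. S ?u e y - e y) \<le> nrm (\<lambda>y. S ?u e y - S (\<tau> n) e y) + nrm (\<lambda>y. S (\<tau> n) e y - e y)"
        using u e_L \<tau>_nonneg by (intro nrm_triangle S_Lp)
      also have "nrm (\<lambda>y. S ?u e y - S (\<tau> n) e y) = nrm (\<lambda>y. S ?u e y - S ?u (S s e) y)"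
      proof (rule nrm_cong)
        have "AE y in M. S (?u + s) e y = S ?u (S s e) y"
          using u s e_L by (intro S_semigroup) auto
        then show "AE y in M. S ?u e y - S (\<tau> n) e y = S ?u e y - S ?u (S s e) y"
          by eventually_elim simp
      qed (use u s e_L \<tau>_nonneg in \<open>auto intro!: L_diff S_Lp\<close>)
      also have "\<dots> \<le> nrm (\<lambda>y. S s e y - e y)"
        using nrm_S_diff[OF u e_L S_Lp[OF _ e_L, of s]] s by (simp add: Lp_on_norm_minus_commute)
      finally have "nrm (\<lambda>y. S ?u e y - e y) \<le> 2 * d" using elim s by simp
      then have "c * nrm (\<lambda>y. S ?u e y - e y) \<le> c * (2 * d)" using c by (intro mult_left_mono)
      also have "\<dots> < v" using v c by (simp add: d_def field_simps)
      finally have "\<bar>point_value x (S ?u e) - v\<bar> < v"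
        using c(2)[of "\<lambda>y. S ?u e y - e y"] u e_L by (simp add: point_value_diff S_Lp L_diff v_def)
      then have "0 < l ?u" using v by (simp add: l_def)
      then have "l (\<tau> n) = l s * l ?u" using l_mult[of s ?u] u s by simp
      also have "\<dots> \<le> l s"
        using l_le_1[OF u] l_nonneg[of s] s by (simp add: mult_left_le)
      finally show ?case .
    qed
    then have "1 \<le> l s"
      using tendsto_upperbound[OF l_tau] by simp
    have s0: "0 \<le> s" using s by simp
    \<comment> \<open>Now \<open>e \<le> l s * e \<le> S s e\<close>, and both ends have the same
      norm.\<close>
    have "AE y in M. e y = S s e y"
    proof (rule Lp_on_norm_strict_mono[OF p])
      show "AE y in M. e y \<le> S s e y"
        using l_le[OF s0]
      proof eventually_elim
        case (elim y)
        have "1 * e y \<le> l s * e y" using \<open>1 \<le> l s\<close> e(2) by (intro mult_right_mono)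
        with elim show ?case by simp
      qed
    qed (use S_isometric[OF e(1) s0] e e_L s0 in \<open>auto intro: L_measurable\<close>)
    then show ?thesis by eventually_elim simp
  qed
  have "\<forall>\<^sub>F t in at_right 0. nrm (\<lambda>y. S t e y - e y) < d"
    using order_tendstoD(2)[OF S_continuous[OF e_L] d] .
  then obtain b where b: "0 < b" "\<And>t. 0 < t \<Longrightarrow> t < b \<Longrightarrow> nrm (\<lambda>y. S t e y - e y) < d"
    by (auto simp: eventually_at_right_field)
  show ?thesis
  proof (cases "s = 0")
    case True
    then show ?thesis using S_zero[OF e_L] by simp
  next
    case False
    with s have s: "0 < s" by simp
    \<comment> \<open>The time \<open>s\<close> is cut into \<open>n\<close> equal steps, each
      shorter than \<open>b\<close>.\<close>
    obtain n where n: "s / b < real n" using reals_Archimedean2 by blast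
    moreover have "0 < s / b" using s b by simp
    ultimately have n0: "0 < real n" by linarith
    have sn: "0 < s / real n" "s / real n < b" using s n n0 b(1) by (auto simp: field_simps)
    from S_multiple[OF e_L _ small[OF sn(1) b(2)[OF sn]], of n] sn n0 show ?thesis by simp
  qed
qed

section \<open>Recurrent functions are fixed\<close>

text \<open>For each \<open>x\<close> with positive value, the least element \<open>e\<close> with
  the same value lies below \<open>g\<close> and is invariant, so evaluating
  \<open>S t e \<le> S t g\<close> shows that the value of \<open>g\<close> does not drop. The
  function \<open>e\<close> depends on \<open>x\<close>, but the resulting inequality does not
  mention it.\<close>

lemma S_nonneg_fixed:
  assumes g: "g \<in> N" "AE y in M. 0 \<le> g y" and t: "0 \<le> t"
  shows "AE y in M. S t g y = g y"
proof -
  have g_L: "g \<in> L" using g by auto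
  have S_nonneg: "AE y in M. 0 \<le> S t g y" by (rule S_pos[OF t g_L g(2)])
  have val: "point_value x g \<le> point_value x (S t g)" for x
  proof (cases "0 < point_value x g")
    case False
    then show ?thesis
      using point_value_nonneg[OF S_Lp[OF t g_L] S_nonneg, of x] by simp
  next
    case True
    obtain e where e: "e \<in> N" "\<And>y. 0 \<le> e y" "point_value x e = point_value x g"
      "\<And>f. f \<in> N \<Longrightarrow> AE y in M. 0 \<le> f y \<Longrightarrow> point_value x f = point_value x g \<Longrightarrow>
        AE y in M. e y \<le> f y"
      using minimal_with_point_value[OF g, of x] by metis
    have e_L: "e \<in> L" using e by auto
    have "AE y in M. S t e y = e y"
      using e True t by (intro minimal_invariant[of e x]) auto
    then have "point_value x e = point_value x (S t e)"
      using point_value_cong[OF S_Lp[OF t e_L] e_L, of x] by simp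
    also have "\<dots> \<le> point_value x (S t g)"
      using e(4)[OF g] t e_L g_L by (intro point_value_mono S_mono) auto
    finally show ?thesis using e(3) by simp
  qed
  \<comment> \<open>The inequality at all points is an inequality between functions of equal norm.
    The isometry of \<open>S 1\<close> on \<open>N\<close> afterwards cancels
    \<open>S 1\<close>.\<close>
  have "AE y in M. S 1 g y = S 1 (S t g) y"
  proof (rule Lp_on_norm_strict_mono[OF p])
    show "AE y in M. S 1 g y \<le> S 1 (S t g) y"
      using point_value_AE[OF g_L] point_value_AE[OF S_Lp[OF t g_L]]
      by eventually_elim (use val in simp)
    show "nrm (S 1 (S t g)) \<le> nrm (S 1 g)"
      using S_isometric g t by (simp add: N_S)
    show "AE y in M. 0 \<le> S 1 g y" using g g_L by (intro S_pos) auto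
  qed (use g_L t in \<open>auto intro: L_measurable S_Lp[OF zero_le_one]\<close>)
  then have "AE y in M. S 1 (\<lambda>y. g y - S t g y) y = 0"
    using S_diff[OF zero_le_one g_L S_Lp[OF t g_L]] by eventually_elim simp
  then have "nrm (S 1 (\<lambda>y. g y - S t g y)) = 0"
    using g_L t by (subst Lp_on_norm_eq_0_iff[OF p]) (auto intro: S_Lp[OF zero_le_one])
  then have "nrm (\<lambda>y. g y - S t g y) = 0"
    using S_isometric[of "\<lambda>y. g y - S t g y" 1] g t by auto
  then have "AE y in M. g y - S t g y = 0"
    using g_L t Lp_on_norm_eq_0_iff[OF p, of "\<lambda>y. g y - S t g y" M] by auto
  then show ?thesis by eventually_elim simp
qed

text \<open>\<open>f\<close> is the difference of the non-negative elements
  \<open>\<bar>f\<bar>\<close> and \<open>\<bar>f\<bar> - f\<close> of \<open>N\<close>.\<close>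

theorem S_fixed:
  assumes f: "f \<in> N" and t: "0 \<le> t"
  shows "AE y in M. S t f y = f y"
proof -
  have f_L: "f \<in> L" using f by auto
  have "AE y in M. S t (\<lambda>y. \<bar>f y\<bar>) y = \<bar>f y\<bar>"
    "AE y in M. S t (\<lambda>y. \<bar>f y\<bar> - f y) y = \<bar>f y\<bar> - f y"
    using f t by (auto intro!: S_nonneg_fixed)
  moreover have "AE y in M. S t (\<lambda>y. \<bar>f y\<bar> - f y) y = S t (\<lambda>y. \<bar>f y\<bar>) y - S t f y"
    using f_L t by (intro S_diff) auto
  ultimately show ?thesis by eventually_elim simp
qed

end

section \<open>Complexification\<close>

text \<open>The set where \<open>g\<close> is negative is open and null, so it contains no point of
  the support.\<close>

lemma full_support_nonneg:
  fixes g :: "'a::t2_space \<Rightarrow> real"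
  assumes "regular_borel_measure M" "measure_support M = UNIV"
    and "continuous_on UNIV g" "AE y in M. 0 \<le> g y"
  shows "0 \<le> g x"
proof (rule ccontr)
  assume "\<not> 0 \<le> g x"
  define U where "U = {y. g y < 0}"
  have U: "open U" "x \<in> U"
    using \<open>\<not> 0 \<le> g x\<close> assms(3) unfolding U_def by (auto intro!: open_Collect_less)
  have sets: "sets M = sets borel" using assms(1) by (simp add: regular_borel_measure_def)
  then have space: "space M = UNIV" by (simp add: sets_eq_imp_space_eq)
  have "U \<in> sets M" using U sets by auto
  then have "emeasure M U = 0"
    using assms(4) space
    by (subst (asm) AE_iff_measurable[of U]) (auto simp: U_def not_le)
  moreover have "0 < emeasure M U"
    using assms(2) U unfolding measure_support_def by blast
  ultimately show False by simp
qed

section \<open>Reduction of the complex semigroup to its real part\<close>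

locale complex_Feller_semigroup =
  fixes M :: "'a::t2_space measure" and p :: real
    and T :: "real \<Rightarrow> ('a \<Rightarrow> complex) \<Rightarrow> 'a \<Rightarrow> complex"
  assumes regular: "regular_borel_measure M"
    and support: "measure_support M = UNIV"
    and p_ge_1: "1 \<le> p"
    and contraction: "contraction_semigroup p M T"
    and positive: "positive_semigroup p M T"
    and Feller: "Feller_property p M T"
begin

abbreviation cnrm where "cnrm \<equiv> Lp_on_norm p M :: ('a \<Rightarrow> complex) \<Rightarrow> real"
abbreviation CL where "CL \<equiv> Lp_on p M :: ('a \<Rightarrow> complex) set"

lemma semigroup: "one_parameter_semigroup p M T"
  using contraction by (simp add: contraction_semigroup_def)

lemma
  assumes "0 \<le> t" "f \<in> CL"
  shows T_Lp: "T t f \<in> CL"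
    and T_cong: "g \<in> CL \<Longrightarrow> AE x in M. f x = g x \<Longrightarrow> AE x in M. T t f x = T t g x"
    and T_add: "g \<in> CL \<Longrightarrow> AE x in M. T t (\<lambda>y. f y + g y) x = T t f x + T t g x"
    and T_scale: "AE x in M. T t (\<lambda>y. c * f y) x = c * T t f x"
proof -
  have "bounded_operator_Lp p M (T t)"
    using semigroup assms(1) by (simp add: one_parameter_semigroup_def)
  note * = this[unfolded bounded_operator_Lp_def Lp_eq_Lp_on, THEN conjunct1]
    this[unfolded bounded_operator_Lp_def Lp_eq_Lp_on, THEN conjunct2, THEN conjunct1]
    this[unfolded bounded_operator_Lp_def Lp_eq_Lp_on, THEN conjunct2, THEN conjunct2, THEN conjunct1]
    this[unfolded bounded_operator_Lp_def Lp_eq_Lp_on, THEN conjunct2, THEN conjunct2, THEN conjunct2, THEN conjunct1]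
  show "T t f \<in> CL" using *(1) assms(2) by blast
  show "AE x in M. T t f x = T t g x" if "g \<in> CL" "AE x in M. f x = g x"
    using *(2) assms(2) that by blast
  show "AE x in M. T t (\<lambda>y. f y + g y) x = T t f x + T t g x" if "g \<in> CL"
    using *(3) assms(2) that by blast
  show "AE x in M. T t (\<lambda>y. c * f y) x = c * T t f x"
    using *(4) assms(2) by blast
qed

lemma T_contraction: "0 \<le> t \<Longrightarrow> f \<in> CL \<Longrightarrow> cnrm (T t f) \<le> cnrm f"
  using contraction by (simp add: contraction_semigroup_def Lp_eq_Lp_on Lp_norm_eq_Lp_on_norm)

lemma T_zero: "f \<in> CL \<Longrightarrow> AE x in M. T 0 f x = f x"
  using semigroup by (simp add: one_parameter_semigroup_def Lp_eq_Lp_on)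

lemma T_semigroup: "0 \<le> s \<Longrightarrow> 0 \<le> t \<Longrightarrow> f \<in> CL \<Longrightarrow> AE x in M. T (s + t) f x = T s (T t f) x"
  using semigroup by (simp add: one_parameter_semigroup_def Lp_eq_Lp_on)

lemma T_continuous:
  "0 \<le> t \<Longrightarrow> f \<in> CL \<Longrightarrow> ((\<lambda>u. cnrm (\<lambda>x. T u f x - T t f x)) \<longlongrightarrow> 0) (at t within {0..})"
  using semigroup by (simp add: one_parameter_semigroup_def Lp_eq_Lp_on Lp_norm_eq_Lp_on_norm)

lemma T_cnj: "0 \<le> t \<Longrightarrow> f \<in> CL \<Longrightarrow> AE x in M. T t (\<lambda>y. cnj (f y)) x = cnj (T t f x)"
  using positive by (simp add: positive_semigroup_def Lp_eq_Lp_on)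

lemma T_pos: "0 \<le> t \<Longrightarrow> f \<in> CL \<Longrightarrow> AE x in M. f x \<in> \<real>\<^sub>\<ge>\<^sub>0 \<Longrightarrow> AE x in M. T t f x \<in> \<real>\<^sub>\<ge>\<^sub>0"
  using positive by (simp add: positive_semigroup_def Lp_eq_Lp_on)

lemma T_Feller: "0 < t \<Longrightarrow> f \<in> CL \<Longrightarrow> \<exists>g. continuous_on UNIV g \<and> (AE x in M. T t f x = g x)"
  using Feller by (simp add: Feller_property_def Lp_eq_Lp_on)

lemma T_diff:
  assumes "0 \<le> t" "f \<in> CL" "g \<in> CL"
  shows "AE x in M. T t (\<lambda>y. f y - g y) x = T t f x - T t g x"
  using T_add[OF assms(1,2) Lp_on_mult(1)[OF p_ge_1 assms(3), of "-1"]] T_scale[OF assms(1,3), of "-1"]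
  by eventually_elim simp

text \<open>For real \<open>f\<close> the function \<open>T t f\<close> is real only almost
  everywhere, as representatives are arbitrary on null sets; \<open>Re\<close> selects a genuinely
  real-valued one.\<close>

definition real_part_semigroup :: "real \<Rightarrow> ('a \<Rightarrow> real) \<Rightarrow> 'a \<Rightarrow> real" where
  "real_part_semigroup t f x = Re (T t (\<lambda>y. complex_of_real (f y)) x)"

abbreviation S where "S \<equiv> real_part_semigroup"

lemma T_of_real:
  assumes "0 \<le> t" "f \<in> Lp_on p M"
  shows "AE x in M. T t (\<lambda>y. complex_of_real (f y)) x = complex_of_real (S t f x)"
  using T_cnj[OF assms(1) Lp_on_of_real(1)[OF assms(2)]]
  by eventually_elim (simp add: real_part_semigroup_def complex_eq_iff)

sublocale real: positive_Feller_semigroup M p S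
proof
  note cr = Lp_on_of_real(1)
  show "1 \<le> p" by (rule p_ge_1)
  show S_Lp: "S t f \<in> Lp_on p M" if "0 \<le> t" "f \<in> Lp_on p M" for t f
    using Lp_on_part(1)[OF p_ge_1 T_Lp[OF that(1) cr[OF that(2)]], of Re]
    by (simp add: real_part_semigroup_def[abs_def])
  show "AE x in M. S t f x = S t g x"
    if "0 \<le> t" "f \<in> Lp_on p M" "g \<in> Lp_on p M" "AE x in M. f x = g x" for t f g
  proof -
    have "AE x in M. T t (\<lambda>y. complex_of_real (f y)) x = T t (\<lambda>y. complex_of_real (g y)) x"
      by (intro T_cong that(1-3) cr, use that(4) in eventually_elim) simp
    then show ?thesis by eventually_elim (simp add: real_part_semigroup_def)
  qed
  show "AE x in M. S t (\<lambda>y. f y + g y) x = S t f x + S t g x"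
    if "0 \<le> t" "f \<in> Lp_on p M" "g \<in> Lp_on p M" for t f g
    using T_add[OF that(1) cr[OF that(2)] cr[OF that(3)]]
    by eventually_elim (simp add: real_part_semigroup_def)
  show "AE x in M. S t (\<lambda>y. c * f y) x = c * S t f x"
    if "0 \<le> t" "f \<in> Lp_on p M" for t f c
    using T_scale[OF that(1) cr[OF that(2)], of c]
    by eventually_elim (simp add: real_part_semigroup_def)
  show "AE x in M. 0 \<le> S t f x"
    if "0 \<le> t" "f \<in> Lp_on p M" "AE x in M. 0 \<le> f x" for t f
  proof -
    have "AE x in M. T t (\<lambda>y. complex_of_real (f y)) x \<in> \<real>\<^sub>\<ge>\<^sub>0"
      by (intro T_pos that(1,2) cr, use that(3) in eventually_elim) simp
    then show ?thesis
      by eventually_elim (simp add: real_part_semigroup_def complex_nonneg_Reals_iff)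
  qed
  show "Lp_on_norm p M (S t f) \<le> Lp_on_norm p M f" if "0 \<le> t" "f \<in> Lp_on p M" for t f
    using Lp_on_part(2)[OF p_ge_1 T_Lp[OF that(1) cr[OF that(2)]], of Re]
      T_contraction[OF that(1) cr[OF that(2)]] Lp_on_of_real(2)[OF that(2)]
    by (simp add: real_part_semigroup_def[abs_def])
  show "AE x in M. S (s + t) f x = S s (S t f) x"
    if "0 \<le> s" "0 \<le> t" "f \<in> Lp_on p M" for s t f
  proof -
    have "AE x in M. T s (T t (\<lambda>y. complex_of_real (f y))) x = T s (\<lambda>y. complex_of_real (S t f y)) x"
      by (rule T_cong[OF that(1) T_Lp[OF that(2) cr[OF that(3)]] cr[OF S_Lp[OF that(2,3)]]
            T_of_real[OF that(2,3)]])
    then show ?thesis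
      using T_semigroup[OF that(1,2) cr[OF that(3)]]
      by eventually_elim (simp add: real_part_semigroup_def)
  qed
  show "AE x in M. S 0 f x = f x" if "f \<in> Lp_on p M" for f
    using T_zero[OF cr[OF that]]
    by eventually_elim (simp add: real_part_semigroup_def)
  show "((\<lambda>t. Lp_on_norm p M (\<lambda>x. S t f x - f x)) \<longlongrightarrow> 0) (at_right 0)"
    if f: "f \<in> Lp_on p M" for f
  proof (rule Lim_null_comparison)
    let ?f = "\<lambda>y. complex_of_real (f y)"
    show "((\<lambda>t. cnrm (\<lambda>x. T t ?f x - T 0 ?f x)) \<longlongrightarrow> 0) (at_right 0)"
      by (rule tendsto_within_subset[OF T_continuous[OF order_refl cr[OF f]]]) auto
    have "\<forall>\<^sub>F t in at_right 0. 0 < (t :: real)" by (rule eventually_at_right_less)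
    then show "\<forall>\<^sub>F t in at_right 0. norm (Lp_on_norm p M (\<lambda>x. S t f x - f x)) \<le> cnrm (\<lambda>x. T t ?f x - T 0 ?f x)"
    proof eventually_elim
      case (elim t)
      then have t: "0 \<le> t" by simp
      have "Lp_on_norm p M (\<lambda>x. S t f x - f x) \<le> cnrm (\<lambda>x. T t ?f x - T 0 ?f x)"
      proof (rule Lp_on_norm_mono[OF p_ge_1 Lp_on_diff(1)[OF p_ge_1]])
        show "T t ?f \<in> CL" "T 0 ?f \<in> CL" using t f by (auto intro: T_Lp cr)
        show "(\<lambda>x. S t f x - f x) \<in> borel_measurable M"
          by (rule Lp_on_measurable[OF Lp_on_diff(1)[OF p_ge_1 S_Lp[OF t f] f]])
        show "AE x in M. norm (S t f x - f x) \<le> cmod (T t ?f x - T 0 ?f x)"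
          using T_zero[OF cr[OF f]]
        proof eventually_elim
          case (elim x)
          then show ?case
            using abs_Re_le_cmod[of "T t ?f x - T 0 ?f x"] by (simp add: real_part_semigroup_def)
        qed
      qed
      then show ?case by (simp add: Lp_on_norm_nonneg)
    qed
  qed
  show "\<exists>g. continuous_on UNIV g \<and> (AE x in M. S t f x = g x)"
    if f: "f \<in> Lp_on p M" and t: "0 < t" for f t
  proof -
    obtain g where "continuous_on UNIV g" "AE x in M. T t (\<lambda>y. complex_of_real (f y)) x = g x"
      using T_Feller[of t "\<lambda>y. complex_of_real (f y)"] t cr[OF f] by auto
    then show ?thesis
      by (intro exI[of _ "\<lambda>x. Re (g x)"] conjI continuous_intros)
         (auto simp: real_part_semigroup_def elim: eventually_mono)
  qed
  show "0 \<le> g x" if "continuous_on UNIV g" "AE y in M. 0 \<le> g y" for g :: "'a \<Rightarrow> real" and x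
    using full_support_nonneg[OF regular support that] .
qed

text \<open>By complex linearity \<open>T t\<close> is determined by its action on real functions,
  so fixed-point statements can be checked on real and imaginary parts separately.\<close>

lemma T_parts:
  assumes "0 \<le> t" "f \<in> CL"
  shows "AE x in M. T t f x
    = complex_of_real (S t (\<lambda>y. Re (f y)) x) + \<i> * complex_of_real (S t (\<lambda>y. Im (f y)) x)"
proof -
  have parts: "(\<lambda>y. Re (f y)) \<in> Lp_on p M" "(\<lambda>y. Im (f y)) \<in> Lp_on p M"
    using Lp_on_part(1)[OF p_ge_1 assms(2)] by auto
  note cr = Lp_on_of_real(1)[OF parts(1)] Lp_on_of_real(1)[OF parts(2)]
  have "AE x in M. T t (\<lambda>y. complex_of_real (Re (f y)) + \<i> * complex_of_real (Im (f y))) x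
      = T t (\<lambda>y. complex_of_real (Re (f y))) x + T t (\<lambda>y. \<i> * complex_of_real (Im (f y))) x"
    by (intro T_add assms cr Lp_on_mult[OF p_ge_1])
  with T_scale[OF assms(1) cr(2), of \<i>] T_of_real[OF assms(1) parts(1)] T_of_real[OF assms(1) parts(2)]
  show ?thesis by eventually_elim (simp flip: complex_eq)
qed

text \<open>Taking a real or imaginary part commutes with the semigroup and does not increase the
  modulus, so both parts of a recurrent function are recurrent and \<open>S_fixed\<close> applies to
  each.\<close>

lemma recurrent_fixed:
  assumes tau: "\<And>n. 0 \<le> \<tau> n" "filterlim \<tau> at_top sequentially"
    and f: "f \<in> CL" and lim: "(\<lambda>n. cnrm (\<lambda>x. T (\<tau> n) f x - f x)) \<longlonglongrightarrow> 0" and t: "0 \<le> t"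
  shows "AE x in M. T t f x = f x"
proof -
  interpret recurrent_Feller_semigroup M p S \<tau>
    by unfold_locales (use tau in auto)
  have part_N: "(\<lambda>x. \<rho> (f x)) \<in> N" if \<rho>: "\<rho> \<in> {Re, Im}" for \<rho>
  proof (rule NI[OF _ _ lim])
    show part_L: "(\<lambda>x. \<rho> (f x)) \<in> real.L" by (rule Lp_on_part(1)[OF p_ge_1 f \<rho>])
    fix n
    show "real.nrm (\<lambda>x. S (\<tau> n) (\<lambda>x. \<rho> (f x)) x - \<rho> (f x)) \<le> cnrm (\<lambda>x. T (\<tau> n) f x - f x)"
    proof (rule Lp_on_norm_mono[OF p_ge_1 Lp_on_diff(1)[OF p_ge_1 T_Lp[OF tau(1) f] f]])
      show "(\<lambda>x. S (\<tau> n) (\<lambda>x. \<rho> (f x)) x - \<rho> (f x)) \<in> borel_measurable M"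
        using part_L tau(1) by (intro real.L_measurable real.L_diff real.S_Lp)
      show "AE x in M. norm (S (\<tau> n) (\<lambda>x. \<rho> (f x)) x - \<rho> (f x)) \<le> cmod (T (\<tau> n) f x - f x)"
        using T_parts[OF tau(1)[of n] f]
      proof eventually_elim
        case (elim x)
        then have "S (\<tau> n) (\<lambda>x. \<rho> (f x)) x - \<rho> (f x) = \<rho> (T (\<tau> n) f x - f x)"
          using \<rho> by auto
        then show ?case using \<rho> abs_Re_le_cmod abs_Im_le_cmod by auto
      qed
    qed
  qed
  have "AE x in M. S t (\<lambda>x. Re (f x)) x = Re (f x)" "AE x in M. S t (\<lambda>x. Im (f x)) x = Im (f x)"
    by (intro S_fixed part_N t; simp)+
  with T_parts[OF t f] show ?thesis
    by eventually_elim (simp flip: complex_eq)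
qed

section \<open>Eigenvectors with purely imaginary eigenvalues\<close>

text \<open>The error \<open>R h\<close>, the distance between \<open>T h f\<close> and its expected
  multiple of \<open>f\<close>, is subadditive in \<open>h\<close> and of smaller order than
  \<open>h\<close> at 0. Hence \<open>R t \<le> n * R (t / n)\<close> tends to 0, with no
  differential equation in L^p to solve.\<close>

lemma eigenvector_semigroup:
  assumes f: "f \<in> peripheral_eigenspace p M T \<theta>" and t: "0 \<le> t"
  shows "AE x in M. T t f x = exp (\<i> * complex_of_real (\<theta> * t)) * f x"
proof -
  have f_L: "f \<in> CL"
    and gen: "((\<lambda>h. cnrm (\<lambda>x. (T h f x - f x) / complex_of_real h - \<i> * complex_of_real \<theta> * f x)) \<longlongrightarrow> 0) (at_right 0)"
    using f by (auto simp: peripheral_eigenspace_def generator_def Lp_eq_Lp_on Lp_norm_eq_Lp_on_norm)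
  define w where "w h = exp (\<i> * complex_of_real (\<theta> * h))" for h
  have w_norm: "cmod (w h) = 1" for h by (simp add: w_def)
  have w_add: "w (s + h) = w s * w h" for s h
    by (simp add: w_def distrib_left exp_add)
  define R where "R h = cnrm (\<lambda>x. T h f x - w h * f x)" for h
  note mult = Lp_on_mult[OF p_ge_1] and diff = Lp_on_diff[OF p_ge_1] and add = Lp_on_add[OF p_ge_1]
  have R_add: "R (s + h) \<le> R s + R h" if s: "0 \<le> s" and h: "0 \<le> h" for s h
  proof -
    note Lh = T_Lp[OF h f_L] and Ls = T_Lp[OF s f_L]
    \<comment> \<open>The error over \<open>s + h\<close> splits into the error over
      \<open>h\<close> moved by the contraction \<open>T s\<close> and the error over
      \<open>s\<close> multiplied by the unimodular number \<open>w h\<close>.\<close>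
    let ?a = "T s (\<lambda>y. T h f y - w h * f y)" and ?b = "\<lambda>x. w h * (T s f x - w s * f x)"
    have a: "?a \<in> CL" by (intro T_Lp s diff Lh mult f_L)
    have b: "?b \<in> CL" by (intro mult diff Ls f_L)
    have "AE x in M. T (s + h) f x - w (s + h) * f x = ?a x + ?b x"
      using T_semigroup[OF s h f_L] T_diff[OF s Lh mult(1)[OF f_L, of "w h"]] T_scale[OF s f_L, of "w h"]
      by eventually_elim (simp add: w_add algebra_simps)
    then have "R (s + h) = cnrm (\<lambda>x. ?a x + ?b x)"
      unfolding R_def using s h
      by (intro Lp_on_norm_cong_AE Lp_on_measurable[of _ p] add a b diff mult T_Lp f_L)
         (auto elim: eventually_mono)
    also have "\<dots> \<le> cnrm ?a + cnrm ?b" by (rule add(2)[OF a b])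
    also have "cnrm ?a \<le> R h"
      unfolding R_def by (intro T_contraction s diff Lh mult f_L)
    also have "cnrm ?b = R s"
      unfolding R_def using mult(2)[OF diff(1)[OF Ls mult(1)[OF f_L]], of "w h"] by (simp add: w_norm)
    finally show ?thesis by simp
  qed
  have R_mult: "R (real (Suc n) * h) \<le> real (Suc n) * R h" if "0 \<le> h" for n h
  proof (induction n)
    case (Suc n)
    have "real (Suc (Suc n)) * h = h + real (Suc n) * h" by (simp add: algebra_simps)
    then show ?case using R_add[OF that, of "real (Suc n) * h"] Suc that by (simp add: algebra_simps)
  qed simp
  \<comment> \<open>\<open>D h\<close> and \<open>d h\<close> are the errors of the difference
    quotients of the semigroup and of the scalar exponential; both tend to 0, and together they
    control \<open>R h / h\<close>.\<close>
  define D where "D h = cnrm (\<lambda>x. (T h f x - f x) / complex_of_real h - \<i> * complex_of_real \<theta> * f x)" for h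
  define d where "d h = cmod ((w h - 1) / complex_of_real h - \<i> * complex_of_real \<theta>)" for h
  have R_le: "R h \<le> h * (D h + d h * cnrm f)" if h: "0 < h" for h
  proof -
    let ?a = "\<lambda>x. (T h f x - f x) / complex_of_real h - \<i> * complex_of_real \<theta> * f x"
    let ?c = "(w h - 1) / complex_of_real h - \<i> * complex_of_real \<theta>"
    have "?a = (\<lambda>x. (1 / complex_of_real h) * (T h f x - f x) - \<i> * complex_of_real \<theta> * f x)"
      by simp
    also have "\<dots> \<in> CL" using h by (intro diff mult T_Lp f_L) simp
    finally have a: "?a \<in> CL" .
    have c: "(\<lambda>x. ?c * f x) \<in> CL" by (intro mult f_L)
    have "T h f x - w h * f x = complex_of_real h * (?a x - ?c * f x)" for x
      using h by (simp add: field_simps)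
    then have "R h = cnrm (\<lambda>x. complex_of_real h * (?a x - ?c * f x))" by (simp add: R_def)
    also have "\<dots> = h * cnrm (\<lambda>x. ?a x - ?c * f x)"
      using mult(2)[OF diff(1)[OF a c], of "complex_of_real h"] h by simp
    also have "\<dots> \<le> h * (cnrm ?a + cnrm (\<lambda>x. ?c * f x))"
      using h diff(2)[OF a c] by (intro mult_left_mono) auto
    also have "cnrm (\<lambda>x. ?c * f x) = d h * cnrm f"
      unfolding d_def by (rule mult(2)[OF f_L])
    finally show ?thesis by (simp add: D_def)
  qed
  have d_lim: "(d \<longlongrightarrow> 0) (at_right 0)"
  proof -
    have "((\<lambda>z. exp (\<i> * complex_of_real \<theta> * z)) has_field_derivative \<i> * complex_of_real \<theta>) (at 0)"
      by (auto intro!: derivative_eq_intros)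
    then have "((\<lambda>z. (exp (\<i> * complex_of_real \<theta> * z) - 1) / z) \<longlongrightarrow> \<i> * complex_of_real \<theta>) (at 0)"
      by (simp add: DERIV_def)
    moreover have "filterlim complex_of_real (at 0) (at_right 0)"
      by (auto simp: filterlim_at eventually_at_filter intro!: tendsto_eq_intros)
    ultimately have "((\<lambda>h. (exp (\<i> * complex_of_real \<theta> * complex_of_real h) - 1) / complex_of_real h)
        \<longlongrightarrow> \<i> * complex_of_real \<theta>) (at_right 0)"
      by (rule filterlim_compose)
    then have "((\<lambda>h. (w h - 1) / complex_of_real h - \<i> * complex_of_real \<theta>) \<longlongrightarrow> 0) (at_right 0)"
      unfolding w_def by (simp add: LIM_zero_iff mult.assoc)
    then show ?thesis unfolding d_def by (rule tendsto_norm_zero)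
  qed
  have "R t = 0"
  proof (cases "t = 0")
    case True
    have "AE x in M. T 0 f x - w 0 * f x = 0"
      using T_zero[OF f_L] by eventually_elim (simp add: w_def)
    then show ?thesis
      unfolding R_def True
      by (subst Lp_on_norm_eq_0_iff[OF p_ge_1]) (auto intro!: diff mult T_Lp f_L)
  next
    case False
    with t have t: "0 < t" by simp
    have "((\<lambda>h. t * (D h + d h * cnrm f)) \<longlongrightarrow> t * (0 + 0 * cnrm f)) (at_right 0)"
      using gen d_lim unfolding D_def[symmetric] by (intro tendsto_intros)
    moreover have "filterlim (\<lambda>n. t / real (Suc n)) (at_right 0) sequentially"
      using t LIMSEQ_Suc[OF lim_const_over_n[of t]] by (auto simp: filterlim_at simp del: of_nat_Suc)
    ultimately have "(\<lambda>n. t * (D (t / real (Suc n)) + d (t / real (Suc n)) * cnrm f)) \<longlonglongrightarrow> t * (0 + 0 * cnrm f)"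
      by (rule filterlim_compose)
    moreover have "R t \<le> t * (D (t / real (Suc n)) + d (t / real (Suc n)) * cnrm f)" for n
    proof -
      have h: "0 < t / real (Suc n)" using t by simp
      have "R t = R (real (Suc n) * (t / real (Suc n)))" by simp
      also have "\<dots> \<le> real (Suc n) * R (t / real (Suc n))" using h by (intro R_mult) simp
      also have "\<dots> \<le> real (Suc n) * (t / real (Suc n) * (D (t / real (Suc n)) + d (t / real (Suc n)) * cnrm f))"
        by (intro mult_left_mono R_le h) simp
      also have "\<dots> = t * (D (t / real (Suc n)) + d (t / real (Suc n)) * cnrm f)" by simp
      finally show ?thesis .
    qed
    ultimately have "R t \<le> 0"
      using LIMSEQ_le_const[of _ "t * (0 + 0 * cnrm f)" "R t"] by auto
    then show ?thesis using Lp_on_norm_nonneg[of p M] unfolding R_def by (metis antisym)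
  qed
  then have "AE x in M. T t f x - w t * f x = 0"
    using t unfolding R_def
    by (subst (asm) Lp_on_norm_eq_0_iff[OF p_ge_1]) (auto intro!: diff mult T_Lp f_L)
  then show ?thesis by eventually_elim (simp add: w_def)
qed

text \<open>Along multiples of the period \<open>2 * pi / \<bar>\<theta>\<bar>\<close> an
  eigenvector returns exactly, so it is recurrent and therefore fixed at all times. After half a
  period it is also multiplied by -1, so it vanishes.\<close>

lemma peripheral_point_spectrum_trivial: "peripheral_point_spectrum p M T \<subseteq> {0}"
proof
  fix \<theta> assume "\<theta> \<in> peripheral_point_spectrum p M T"
  then obtain f where f: "f \<in> peripheral_eigenspace p M T \<theta>" "\<not> (AE x in M. f x = 0)"
    by (auto simp: peripheral_point_spectrum_def)
  have f_L: "f \<in> CL"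
    using f(1) by (auto simp: peripheral_eigenspace_def generator_def Lp_eq_Lp_on)
  show "\<theta> \<in> {0}"
  proof (rule ccontr)
    assume "\<theta> \<notin> {0}"
    then have \<theta>: "\<theta> \<noteq> 0" by simp
    have minus: "exp (\<i> * complex_of_real (\<theta> * (pi / \<bar>\<theta>\<bar>))) = -1"
      using \<theta> by (cases "\<theta> > 0") (auto simp: exp_minus)
    define \<tau> where "\<tau> n = real n * (2 * pi / \<bar>\<theta>\<bar>)" for n
    have tau: "0 \<le> \<tau> n" for n by (simp add: \<tau>_def)
    have "filterlim \<tau> at_top sequentially"
      unfolding \<tau>_def using \<theta>
      by (intro filterlim_at_top_mult_tendsto_pos[OF tendsto_const _ filterlim_real_sequentially]) simp
    moreover have "cnrm (\<lambda>x. T (\<tau> n) f x - f x) = 0" for n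
    proof -
      \<comment> \<open>The phase is \<open>2 * pi * n\<close> or its negative, according to the
        sign of \<open>\<theta>\<close>; hence the two integer witnesses.\<close>
      have "exp (\<i> * complex_of_real (\<theta> * \<tau> n)) = 1"
        by (subst exp_eq_1) (use \<theta> in \<open>auto simp: \<tau>_def abs_if
              intro: exI[of _ "int n"] exI[of _ "- int n"]\<close>)
      then have "AE x in M. T (\<tau> n) f x - f x = 0"
        using eigenvector_semigroup[OF f(1) tau[of n]] by simp
      then show ?thesis
        by (subst Lp_on_norm_eq_0_iff[OF p_ge_1]) (auto intro!: Lp_on_diff[OF p_ge_1] T_Lp f_L tau)
    qed
    ultimately have "AE x in M. T (pi / \<bar>\<theta>\<bar>) f x = f x"
      using tau f_L by (intro recurrent_fixed[of \<tau>]) auto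
    then have "AE x in M. f x = 0"
      using eigenvector_semigroup[OF f(1), of "pi / \<bar>\<theta>\<bar>", simplified minus, simplified]
    proof eventually_elim
      case (elim x)
      then have "2 * f x = 0" by (simp add: eq_neg_iff_add_eq_0)
      then show ?case by simp
    qed
    then show False using f(2) by simp
  qed
qed

end

theorem theorem12:
  fixes M :: "'a::{t2_space, second_countable_topology} measure"
    and p :: real
    and T :: "real \<Rightarrow> ('a \<Rightarrow> complex) \<Rightarrow> 'a \<Rightarrow> complex"
  assumes "locally_compact_space (euclidean :: 'a topology)"
    and "regular_borel_measure M"
    and "measure_support M = UNIV"
    and "1 \<le> p"
    and "Lp_separable p M"
    and "contraction_semigroup p M T"
    and "positive_semigroup p M T"
    and "Feller_property p M T"
  shows "(\<forall>\<tau> :: nat \<Rightarrow> real.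
            (\<forall>n. 0 \<le> \<tau> n) \<longrightarrow> filterlim \<tau> at_top sequentially \<longrightarrow>
            (\<forall>f\<in>peripheral_subspace p M T.
               (\<lambda>n. Lp_norm p M (\<lambda>x. T (\<tau> n) f x - f x)) \<longlonglongrightarrow> 0) \<longrightarrow>
            (\<forall>t\<ge>0. \<forall>f\<in>real_recurrent_subspace p M T \<tau>. AE x in M. T t f x = f x))
         \<and> peripheral_point_spectrum p M T \<subseteq> {0}"
proof -
  interpret complex_Feller_semigroup M p T
    using assms by unfold_locales
  \<comment> \<open>The real recurrent functions are a special case of the complex ones treated in
    \<open>recurrent_fixed\<close>.\<close>
  have "AE x in M. T t f x = f x"
    if "\<forall>n. 0 \<le> \<tau> n" "filterlim \<tau> at_top sequentially" "0 \<le> t"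
      "f \<in> real_recurrent_subspace p M T \<tau>" for \<tau> t f
    using that by (intro recurrent_fixed[of \<tau>])
      (auto simp: real_recurrent_subspace_def recurrent_subspace_def Lp_eq_Lp_on Lp_norm_eq_Lp_on_norm)
  then show ?thesis using peripheral_point_spectrum_trivial by blast
qed

end
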